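(* For even $n$, let $G_n$ be the random 3-regular graph on $n$ vertices and let $(\hat X^n_k)_{k\ge 0}$ be the discrete time random walk on $G_n$ started at vertex $1$. Let $\hat D^n_k$ be the graph distance in $G_n$ from $\hat X^n_k$ to $\hat X^n_0$. Then for every fixed $t>0$, $$\frac{\hat D^n_{\lfloor t\log_2 n\rfloor}}{\log_2 n}\to \min\left(\frac t3,1\right)\quad\text{in probability as } n\to\infty \text{ through even integers},$$ where the probability is over the joint law of the random graph and the random walk.
   Context: Random 3-regular graph $G_n$ ($n$ even): replace each vertex $i\in\{1,\dots,n\}$ by three "mini-vertices" $3i,3i+1,3i+2$, and choose a uniformly random perfect matching $\sigma$ of the $3n$ mini-vertices ($\sigma(j)$ is the mini-vertex matched to $j$). $G_n$ is the multigraph obtained by collapsing each group of three mini-vertices back to its vertex while keeping the edges of the matching; self-loops and multiple edges are allowed. Random walk: given $G_n$, from its current vertex $j$ the walk jumps to $\lfloor\sigma(3j+i)/3\rfloor$, where $i$ is chosen uniformly at random from $\{0,1,2\}$, independently at each step. *)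

theory Defs
  imports
    "HOL-Probability.Probability"
    "Graph_Theory.Bidirected_Digraph"
    "Graph_Theory.Shortest_Path"
begin

definition mini_vertices :: "nat \<Rightarrow> nat set" where
  "mini_vertices n = {3 * i + r | i r. i \<in> {1..n} \<and> r \<in> {0..<3}}"

text \<open>A perfect matching is given by its partner map: a fixed-point-free involution of the
  mini-vertices, extended by the identity so that distinct maps are distinct matchings.\<close>

definition perfect_matchings :: "nat set \<Rightarrow> (nat \<Rightarrow> nat) set" where
  "perfect_matchings V = {\<sigma>. \<sigma> permutes V \<and> (\<forall>j\<in>V. \<sigma> j \<noteq> j \<and> \<sigma> (\<sigma> j) = j)}"

text \<open>The collapsed multigraph is represented as a symmetric multi-digraph: the matching edge
  \<open>{j, \<sigma> j}\<close> becomes the two opposite arcs \<open>j\<close> and \<open>\<sigma> j\<close>, so \<open>\<sigma>\<close> is the arc reversal.\<close>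

definition cubic_graph :: "nat \<Rightarrow> (nat \<Rightarrow> nat) \<Rightarrow> (nat, nat) pre_digraph" where
  "cubic_graph n \<sigma> =
     \<lparr>verts = {1..n}, arcs = mini_vertices n, tail = (\<lambda>j. j div 3), head = (\<lambda>j. \<sigma> j div 3)\<rparr>"

text \<open>Shortest path length, which is \<open>\<infinity>\<close> between different components.\<close>

definition graph_dist :: "('a, 'b) pre_digraph \<Rightarrow> 'a \<Rightarrow> 'a \<Rightarrow> ereal" where
  "graph_dist G u v = wf_digraph.\<mu> G (\<lambda>_. 1) u v"

text \<open>The randomness consists of the matching \<open>\<sigma>\<close> and an independent sequence \<open>\<omega>\<close> of i.i.d.
  uniform choices in \<open>{0, 1, 2}\<close>, one for each step of the walk.\<close>

definition graph_walk_space :: "nat \<Rightarrow> ((nat \<Rightarrow> nat) \<times> (nat \<Rightarrow> nat)) measure" where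
  "graph_walk_space n =
     measure_pmf (pmf_of_set (perfect_matchings (mini_vertices n))) \<Otimes>\<^sub>M
     (\<Pi>\<^sub>M k\<in>UNIV. measure_pmf (pmf_of_set {0..<3}))"

primrec walk :: "(nat \<Rightarrow> nat) \<times> (nat \<Rightarrow> nat) \<Rightarrow> nat \<Rightarrow> nat" where
  "walk x 0 = 1"
| "walk x (Suc k) = fst x (3 * walk x k + snd x k) div 3"

definition walk_dist :: "nat \<Rightarrow> nat \<Rightarrow> (nat \<Rightarrow> nat) \<times> (nat \<Rightarrow> nat) \<Rightarrow> ereal" where
  "walk_dist n k x = graph_dist (cubic_graph n (fst x)) (walk x k) (walk x 0)"

text \<open>Convergence in probability to a constant, along a filter, for random variables that may
  live on different probability spaces.\<close>

definition tendsto_in_probability ::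
  "('i \<Rightarrow> 'a measure) \<Rightarrow> ('i \<Rightarrow> 'a \<Rightarrow> ereal) \<Rightarrow> real \<Rightarrow> 'i filter \<Rightarrow> bool" where
  "tendsto_in_probability M X c F \<longleftrightarrow>
     (\<forall>\<epsilon>>0. ((\<lambda>n. measure (M n) {x \<in> space (M n). \<bar>X n x - ereal c\<bar> > ereal \<epsilon>}) \<longlongrightarrow> 0) F)"

lemma bidirected_cubic_graph:
  assumes "\<sigma> \<in> perfect_matchings (mini_vertices n)"
  shows "bidirected_digraph (cubic_graph n \<sigma>) \<sigma>"
proof -
  have perm: "\<sigma> permutes mini_vertices n"
    and inv: "\<And>j. j \<in> mini_vertices n \<Longrightarrow> \<sigma> j \<noteq> j \<and> \<sigma> (\<sigma> j) = j"
    using assms by (auto simp: perfect_matchings_def)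
  have div: "j div 3 \<in> {1..n}" if "j \<in> mini_vertices n" for j
    using that by (auto simp: mini_vertices_def)
  interpret wf_digraph "cubic_graph n \<sigma>"
    by unfold_locales
       (use div permutes_in_image[OF perm] in \<open>auto simp: cubic_graph_def simp del: atLeastAtMost_iff\<close>)
  show ?thesis
    by (rule bidirected_digraphI)
       (use inv permutes_not_in[OF perm] in \<open>auto simp: cubic_graph_def\<close>)
qed

lemma prob_space_graph_walk_space: "prob_space (graph_walk_space n)"
proof -
  have "prob_space (\<Pi>\<^sub>M k\<in>(UNIV::nat set). measure_pmf (pmf_of_set {0..<3::nat}))"
    by (intro prob_space_PiM prob_space_measure_pmf)
  then show ?thesis
    unfolding graph_walk_space_def by (intro prob_space_pair prob_space_measure_pmf)
qed

lemma measurable_apply_matching: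
  fixes f :: "(nat \<Rightarrow> nat) \<Rightarrow> nat \<Rightarrow> 'a"
  assumes "g \<in> graph_walk_space n \<rightarrow>\<^sub>M count_space UNIV" and "\<And>m. range (\<lambda>\<sigma>. f \<sigma> m) \<subseteq> space N"
  shows "(\<lambda>x. f (fst x) (g x)) \<in> graph_walk_space n \<rightarrow>\<^sub>M N"
proof (rule measurable_compose_countable[OF _ assms(1)])
  fix m
  have "(\<lambda>\<sigma>. f \<sigma> m) \<in> measure_pmf (pmf_of_set (perfect_matchings (mini_vertices n))) \<rightarrow>\<^sub>M N"
    using assms(2) by (auto simp: measurable_def)
  then show "(\<lambda>x. f (fst x) m) \<in> graph_walk_space n \<rightarrow>\<^sub>M N"
    unfolding graph_walk_space_def by (rule measurable_compose[OF measurable_fst])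
qed

lemma measurable_walk: "(\<lambda>x. walk x k) \<in> graph_walk_space n \<rightarrow>\<^sub>M count_space UNIV"
proof (induction k)
  case (Suc k)
  have "(\<lambda>x. snd x k) \<in> graph_walk_space n \<rightarrow>\<^sub>M count_space UNIV"
    unfolding graph_walk_space_def by measurable
  with Suc have "(\<lambda>x. 3 * walk x k + snd x k) \<in> graph_walk_space n \<rightarrow>\<^sub>M count_space UNIV"
    by measurable
  then show ?case
    using measurable_apply_matching[where f = "\<lambda>\<sigma> m. \<sigma> m div 3" and N = "count_space UNIV"]
    by simp
qed simp

lemma borel_measurable_walk_dist: "walk_dist n k \<in> borel_measurable (graph_walk_space n)"
  using measurable_apply_matching[OF measurable_walk, where N = borel
      and f = "\<lambda>\<sigma> v. graph_dist (cubic_graph n \<sigma>) v 1"]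
  by (simp add: walk_dist_def[abs_def])

end

theory Submission
  imports Defs "HOL-Real_Asymp.Real_Asymp"
begin

text \<open>
  Reducing the trajectory of the walk in the universal cover, the 3-regular tree, shows that the
  position after \<open>k\<close> steps is the end of a uniform non-backtracking path of random length \<open>m\<close>. The
  length is a birth-death chain that does not depend on the matching, with drift \<open>1/3\<close>, so \<open>m\<close> is
  close to \<open>k/3\<close>. It therefore suffices to understand a uniform non-backtracking path of fixed length.

  For two different non-backtracking itineraries of length \<open>m\<close>, the probability over the matching
  that both paths are self-avoiding and end at the same vertex is at most \<open>3 / (3n - 4m)\<close>. Hence the
  law \<open>q\<^sub>m\<close> of the endpoint, restricted to self-avoiding paths, satisfies
  \<open>E \<Sum>\<^sub>v q\<^sub>m(v)\<^sup>2 \<le> 2\<^sup>-\<^sup>m + 3 / (3n - 4m)\<close>. By Cauchy--Schwarz the path rarely ends in a random set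
  that is small on average. This applies to the ball of radius \<open>(min (t/3) 1 - \<epsilon>) log\<^sub>2 n\<close> about the
  start, which has at most \<open>3 \<cdot> 2\<^sup>r\<close> points. It also applies to the complement of the set reached
  by paths of length \<open>l = (1 + \<epsilon>) log\<^sub>2 n\<close>: the second moment is \<open>(1 + o(1)) / n\<close> there, and Cauchy--Schwarz
  on the support of \<open>q\<^sub>l\<close> shows that this set misses only \<open>o(n)\<close> vertices.
\<close>

section \<open>Non-backtracking paths\<close>

text \<open>Mini-vertices are called darts. A path is given by its list of turns, the most recent one first,
  and \<open>arr\<close> is the dart through which it arrives. The dart 5 at vertex 1 serves as the arrival dart of
  the empty path: with turns \<open>c < 3\<close>, the dart \<open>nbd 5 c = 3 + c\<close> is any dart at vertex 1, while
  \<open>nbd g 0\<close> and \<open>nbd g 1\<close> are the two darts at the vertex of \<open>g\<close> other than \<open>g\<close>.\<close>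

definition nbd :: "nat \<Rightarrow> nat \<Rightarrow> nat" where
  "nbd g c = 3 * (g div 3) + (g mod 3 + 1 + c) mod 3"

primrec arr :: "(nat \<Rightarrow> nat) \<Rightarrow> nat list \<Rightarrow> nat" where
  "arr \<sigma> [] = 5"
| "arr \<sigma> (c # w) = \<sigma> (nbd (arr \<sigma> w) c)"

text \<open>The explored darts, whose partners are known once the path has been followed. They serve
  as the set \<open>E\<close> of \<open>card_matchings_hit\<close>.\<close>

primrec expl :: "(nat \<Rightarrow> nat) \<Rightarrow> nat list \<Rightarrow> nat set" where
  "expl \<sigma> [] = {}"
| "expl \<sigma> (c # w) = {nbd (arr \<sigma> w) c, \<sigma> (nbd (arr \<sigma> w) c)} \<union> expl \<sigma> w"

primrec vis :: "(nat \<Rightarrow> nat) \<Rightarrow> nat list \<Rightarrow> nat set" where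
  "vis \<sigma> [] = {1}"
| "vis \<sigma> (c # w) = insert (arr \<sigma> (c # w) div 3) (vis \<sigma> w)"

text \<open>Self-avoidance in the sense of vertices. The tail of the list is the earlier part of the
  path, so each new vertex is tested against all previous ones.\<close>

primrec simple_word :: "(nat \<Rightarrow> nat) \<Rightarrow> nat list \<Rightarrow> bool" where
  "simple_word \<sigma> [] \<longleftrightarrow> True"
| "simple_word \<sigma> (c # w) \<longleftrightarrow> simple_word \<sigma> w \<and> arr \<sigma> (c # w) div 3 \<notin> vis \<sigma> w"

text \<open>The turn 2 would give \<open>nbd g 2 = g\<close> and backtrack, so only 0 and 1 are
  allowed. The first step has three choices because no edge has been used before it.\<close>

primrec nb_words :: "nat \<Rightarrow> nat list set" where
  "nb_words 0 = {[]}"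
| "nb_words (Suc m) = (\<lambda>(c, w). c # w) ` ({..<if m = 0 then 3 else 2} \<times> nb_words m)"

declare nb_words.simps(2) [simp del]

lemma finite_nb_words: "finite (nb_words m)"
  by (induction m) (simp_all add: nb_words.simps(2))

lemma card_nb_words_Suc: "card (nb_words (Suc m)) = (if m = 0 then 3 else 2) * card (nb_words m)"
proof -
  have "inj_on (\<lambda>(c, w). c # w) ({..<if m = 0 then 3 else 2::nat} \<times> nb_words m)"
    by (auto intro: inj_onI)
  then show ?thesis
    by (simp add: nb_words.simps(2) card_image card_cartesian_product)
qed

lemma card_nb_words: "2 * card (nb_words (Suc m)) = 3 * 2 ^ Suc m"
  by (induction m) (simp_all add: card_nb_words_Suc)

lemma card_nb_words_le: "2 * card (nb_words m) \<le> 3 * 2 ^ m"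
  by (cases m) (simp_all add: card_nb_words)

lemma card_nb_words_ge: "2 ^ m \<le> card (nb_words m)"
  using card_nb_words[of "m - 1"] by (cases m) (simp_all)

lemma length_nb_words: "w \<in> nb_words m \<Longrightarrow> length w = m"
  by (induction m arbitrary: w) (auto simp add: nb_words.simps(2))

lemma Cons_in_nb_words:
  assumes "c # w \<in> nb_words m"
  obtains m' where "m = Suc m'" "w \<in> nb_words m'" "c < (if m' = 0 then 3 else 2)"
  using assms by (cases m) (auto simp add: nb_words.simps(2) split: if_splits)

section \<open>Arithmetic of turns\<close>

lemma nbd_div [simp]: "nbd g c div 3 = g div 3"
  by (simp add: nbd_def)

lemma less_3_cases: "(k::nat) < 3 \<longleftrightarrow> k = 0 \<or> k = 1 \<or> k = 2"
  by arith

lemma mod_3_cases: "(k::nat) mod 3 = 0 \<or> k mod 3 = 1 \<or> k mod 3 = 2"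
  using less_3_cases[of "k mod 3"] by simp

lemma nbd_inject: "c < 3 \<Longrightarrow> c' < 3 \<Longrightarrow> nbd g c = nbd g c' \<longleftrightarrow> c = c'"
  unfolding nbd_def less_3_cases using mod_3_cases[of g] by (elim disjE) simp_all

lemma nbd_inject_left:
  assumes e: "nbd g c = nbd g' c"
  shows "g = g'"
proof -
  have d: "g div 3 = g' div 3" using e by (metis nbd_div)
  have "(g mod 3 + 1 + c mod 3) mod 3 = (g' mod 3 + 1 + c mod 3) mod 3"
    using e d by (simp only: nbd_def mod_add_right_eq add_left_cancel)
  then have "g mod 3 = g' mod 3"
    using mod_3_cases[of g] mod_3_cases[of g'] mod_3_cases[of c] by (elim disjE) simp_all
  with d show ?thesis by (metis div_mult_mod_eq)
qed

lemma nbd_neq: "c < 2 \<Longrightarrow> nbd g c \<noteq> g"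
proof
  assume c: "c < 2" and e: "nbd g c = g"
  have "3 * (g div 3) + (g mod 3 + 1 + c) mod 3 = 3 * (g div 3) + g mod 3"
    using e by (simp add: nbd_def)
  moreover have "c = 0 \<or> c = 1" using c by arith
  ultimately show False using mod_3_cases[of g] by (elim disjE) simp_all
qed

lemma ex_nbd:
  assumes "h div 3 = g div 3" "h \<noteq> g"
  shows "\<exists>c<2. h = nbd g c"
proof -
  have h: "h = 3 * (g div 3) + h mod 3" using assms(1) by (metis mult_div_mod_eq)
  have "h mod 3 \<noteq> g mod 3" using assms by (metis div_mult_mod_eq)
  then have "h mod 3 = (g mod 3 + 1 + 0) mod 3 \<or> h mod 3 = (g mod 3 + 1 + 1) mod 3"
    using mod_3_cases[of g] mod_3_cases[of h] by (elim disjE) simp_all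
  then have "h = nbd g 0 \<or> h = nbd g 1"
    unfolding nbd_def using h by metis
  then show ?thesis by force
qed

section \<open>Darts and perfect matchings\<close>

lemma mini_vertices_eq: "mini_vertices n = {3..<3 * n + 3}"
proof -
  have "j \<in> mini_vertices n" if "j \<in> {3..<3 * n + 3}" for j
  proof -
    have "j = 3 * (j div 3) + j mod 3" "j div 3 \<in> {1..n}" "j mod 3 \<in> {0..<3}"
      using that by auto
    then show ?thesis unfolding mini_vertices_def by blast
  qed
  then show ?thesis by (auto simp: mini_vertices_def)
qed

lemma mini_vertices_iff: "j \<in> mini_vertices n \<longleftrightarrow> j div 3 \<in> {1..n}"
  unfolding mini_vertices_eq by auto

lemma finite_mini_vertices [simp]: "finite (mini_vertices n)"
  and card_mini_vertices [simp]: "card (mini_vertices n) = 3 * n"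
  by (simp_all add: mini_vertices_eq)

lemma nbd_in: "nbd g c \<in> mini_vertices n \<longleftrightarrow> g \<in> mini_vertices n"
  by (simp add: mini_vertices_iff)

lemma matching_apply:
  assumes "\<sigma> \<in> perfect_matchings V"
  shows "j \<in> V \<Longrightarrow> \<sigma> j \<in> V" "j \<in> V \<Longrightarrow> \<sigma> j \<noteq> j" "\<sigma> (\<sigma> j) = j" "j \<notin> V \<Longrightarrow> \<sigma> j = j" "\<sigma> i = \<sigma> j \<longleftrightarrow> i = j"
proof -
  have p: "\<sigma> permutes V" and i: "\<And>j. j \<in> V \<Longrightarrow> \<sigma> j \<noteq> j \<and> \<sigma> (\<sigma> j) = j"
    using assms by (auto simp: perfect_matchings_def)
  show "j \<in> V \<Longrightarrow> \<sigma> j \<in> V" "j \<in> V \<Longrightarrow> \<sigma> j \<noteq> j" "j \<notin> V \<Longrightarrow> \<sigma> j = j"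
    using permutes_in_image[OF p] permutes_not_in[OF p] i by auto
  show "\<sigma> (\<sigma> j) = j" using i permutes_not_in[OF p] by (cases "j \<in> V") auto
  show "\<sigma> i = \<sigma> j \<longleftrightarrow> i = j" using permutes_inj[OF p] by (auto simp: inj_def)
qed

lemma finite_perfect_matchings: "finite V \<Longrightarrow> finite (perfect_matchings V)"
  by (rule finite_subset[OF _ finite_permutations[of V]]) (auto simp: perfect_matchings_def)

lemma perfect_matchings_nonempty:
  assumes "even n"
  shows "perfect_matchings (mini_vertices n) \<noteq> {}"
proof -
  \<comment> \<open>The darts are the integers from 3 to \<open>3 * n + 2\<close>. For even
    \<open>n\<close> this interval starts odd and ends even, so each odd dart can be paired with its
    successor.\<close>
  define f where "f j = (if j \<in> mini_vertices n then if odd j then j + 1 else j - 1 else j)" for j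
  have ff: "f (f j) = j" and fV: "j \<in> mini_vertices n \<Longrightarrow> f j \<in> mini_vertices n \<and> f j \<noteq> j" for j
    using assms unfolding f_def mini_vertices_eq by (auto elim!: oddE evenE) presburger+
  have "bij f" using ff by (metis bijI' )
  then have "f permutes mini_vertices n"
    unfolding permutes_def by (auto simp: f_def bij_iff)
  then have "f \<in> perfect_matchings (mini_vertices n)"
    using ff fV by (auto simp: perfect_matchings_def)
  then show ?thesis by auto
qed

section \<open>Revealing the matching\<close>

lemma conj_transpose_matching:
  assumes "\<sigma> \<in> perfect_matchings V" "a \<in> V" "b \<in> V"
  shows "Transposition.transpose a b \<circ> \<sigma> \<circ> Transposition.transpose a b \<in> perfect_matchings V"
proof -
  have p: "\<sigma> permutes V" using assms(1) by (auto simp: perfect_matchings_def)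
  have t: "Transposition.transpose a b permutes V" by (rule permutes_swap_id) fact+
  have "Transposition.transpose a b \<circ> \<sigma> \<circ> Transposition.transpose a b permutes V"
    by (intro permutes_compose p t)
  moreover have "\<sigma> (Transposition.transpose a b j) \<noteq> Transposition.transpose a b j" if "j \<in> V" for j
    using matching_apply(2)[OF assms(1)] permutes_in_image[OF t] that by auto
  then have "Transposition.transpose a b (\<sigma> (Transposition.transpose a b j)) \<noteq> j" if "j \<in> V" for j
    using that by (metis transpose_involutory)
  ultimately show ?thesis
    by (simp add: perfect_matchings_def matching_apply(3)[OF assms(1)])
qed

text \<open>Once the pairs inside \<open>E \<sigma>\<close> are revealed, the partner of a dart outside is uniform among the
  remaining ones: conjugating \<open>\<sigma>\<close> by the transposition of \<open>\<sigma> (x \<sigma>)\<close> and \<open>y\<close> makes \<open>y\<close> the partner and keeps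
  everything revealed.\<close>

lemma card_matchings_hit:
  fixes V :: "nat set" and x :: "(nat \<Rightarrow> nat) \<Rightarrow> nat" and E T :: "(nat \<Rightarrow> nat) \<Rightarrow> nat set"
  defines "M \<equiv> perfect_matchings V"
  assumes V: "finite V"
    and E: "\<And>\<sigma>. \<sigma> \<in> M \<Longrightarrow> E \<sigma> \<subseteq> V \<and> \<sigma> ` E \<sigma> \<subseteq> E \<sigma> \<and> card (E \<sigma>) \<le> K"
    and x: "\<And>\<sigma>. \<sigma> \<in> M \<Longrightarrow> x \<sigma> \<in> V"
    and T: "\<And>\<sigma>. \<sigma> \<in> M \<Longrightarrow> finite (T \<sigma>) \<and> card (T \<sigma>) \<le> \<tau>"
    and agree: "\<And>\<sigma> \<sigma>'. \<sigma> \<in> M \<Longrightarrow> \<sigma>' \<in> M \<Longrightarrow> (\<And>e. e \<in> E \<sigma> \<Longrightarrow> \<sigma>' e = \<sigma> e) \<Longrightarrow>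
      E \<sigma>' = E \<sigma> \<and> x \<sigma>' = x \<sigma> \<and> T \<sigma>' = T \<sigma>"
  shows "card {\<sigma> \<in> M. x \<sigma> \<notin> E \<sigma> \<and> \<sigma> (x \<sigma>) \<in> T \<sigma>} * (card V - K - 1) \<le> \<tau> * card M"
proof -
  define B where "B = {\<sigma> \<in> M. x \<sigma> \<notin> E \<sigma> \<and> \<sigma> (x \<sigma>) \<in> T \<sigma>}"
  have fM: "finite M" unfolding M_def by (rule finite_perfect_matchings[OF V])
  then have fB: "finite B" by (simp add: B_def)
  \<comment> \<open>Double counting: \<open>P\<close> joins each matching of \<open>B\<close> to
    every possible new partner \<open>y\<close>, and \<open>\<phi>\<close> switches to
    \<open>y\<close> while recording the old partner, which lies in the unchanged set
    \<open>T\<close>.\<close>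
  define P where "P = Sigma B (\<lambda>\<sigma>. V - E \<sigma> - {x \<sigma>})"
  define \<phi> where "\<phi> = (\<lambda>(\<sigma>, y). (Transposition.transpose (\<sigma> (x \<sigma>)) y \<circ> \<sigma> \<circ> Transposition.transpose (\<sigma> (x \<sigma>)) y, \<sigma> (x \<sigma>)))"
  have key: "\<sigma>' \<in> M \<and> E \<sigma>' = E \<sigma> \<and> x \<sigma>' = x \<sigma> \<and> T \<sigma>' = T \<sigma> \<and> \<sigma>' (x \<sigma>) = y"
    if "(\<sigma>, y) \<in> P" and \<sigma>': "\<sigma>' = Transposition.transpose (\<sigma> (x \<sigma>)) y \<circ> \<sigma> \<circ> Transposition.transpose (\<sigma> (x \<sigma>)) y" for \<sigma> y \<sigma>'
  proof -
    have s: "\<sigma> \<in> M" "x \<sigma> \<notin> E \<sigma>" "y \<in> V" "y \<notin> E \<sigma>" "y \<noteq> x \<sigma>"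
      using that(1) by (auto simp: P_def B_def)
    note m = matching_apply[OF s(1)[unfolded M_def]]
    have "\<sigma>' \<in> M"
      unfolding \<sigma>' M_def using s m(1) x[OF s(1)]
      by (intro conj_transpose_matching) (auto simp: M_def)
    moreover have "\<sigma> (x \<sigma>) \<notin> E \<sigma>" using E[OF s(1)] s(2) m(3) by (metis image_subset_iff)
    moreover have "\<sigma>' e = \<sigma> e" if "e \<in> E \<sigma>" for e
    proof -
      have "\<sigma> e \<in> E \<sigma>" using E[OF s(1)] that by auto
      with that calculation s show ?thesis
        unfolding \<sigma>' by (auto simp: Transposition.transpose_def)
    qed
    moreover have "\<sigma>' (x \<sigma>) = y"
      unfolding \<sigma>' using s m(2)[OF x[OF s(1)]] by (auto simp: Transposition.transpose_def)
    ultimately show ?thesis using agree[OF s(1)] by blast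
  qed
  have "\<phi> ` P \<subseteq> Sigma M T"
  proof (clarify)
    fix \<sigma> y \<sigma>' z assume P: "(\<sigma>, y) \<in> P" and e: "(\<sigma>', z) = \<phi> (\<sigma>, y)"
    then have "\<sigma>' = Transposition.transpose (\<sigma> (x \<sigma>)) y \<circ> \<sigma> \<circ> Transposition.transpose (\<sigma> (x \<sigma>)) y" "z = \<sigma> (x \<sigma>)"
      by (auto simp: \<phi>_def)
    with key[OF P] P show "\<sigma>' \<in> M \<and> z \<in> T \<sigma>'" by (auto simp: P_def B_def)
  qed
  moreover have "inj_on \<phi> P"
  proof (rule inj_on_inverseI[where g = "\<lambda>(\<sigma>', z). (Transposition.transpose z (\<sigma>' (x \<sigma>')) \<circ> \<sigma>' \<circ> Transposition.transpose z (\<sigma>' (x \<sigma>')), \<sigma>' (x \<sigma>'))"])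
    fix p assume "p \<in> P"
    then obtain \<sigma> y where p: "p = (\<sigma>, y)" "(\<sigma>, y) \<in> P" by (cases p) auto
    show "(\<lambda>(\<sigma>', z). (Transposition.transpose z (\<sigma>' (x \<sigma>')) \<circ> \<sigma>' \<circ> Transposition.transpose z (\<sigma>' (x \<sigma>')), \<sigma>' (x \<sigma>'))) (\<phi> p) = p"
      using key[OF p(2) refl] by (auto simp: p(1) \<phi>_def fun_eq_iff)
  qed
  moreover have "finite (Sigma M T)" using fM T by auto
  ultimately have "card P \<le> card (Sigma M T)" by (metis card_inj_on_le)
  also have "\<dots> = (\<Sum>\<sigma>\<in>M. card (T \<sigma>))" using fM T by simp
  also have "\<dots> \<le> \<tau> * card M" using sum_bounded_above[of M "\<lambda>\<sigma>. card (T \<sigma>)" \<tau>] T by (simp add: mult.commute)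
  finally have "card P \<le> \<tau> * card M" .
  moreover have "card B * (card V - K - 1) \<le> card P"
  proof -
    have "card V - K - 1 \<le> card (V - E \<sigma> - {x \<sigma>})" if "\<sigma> \<in> B" for \<sigma>
    proof -
      have s: "\<sigma> \<in> M" using that by (simp add: B_def)
      have "card V - card (E \<sigma>) \<le> card (V - E \<sigma>)"
        using E[OF s] V by (metis diff_card_le_card_Diff finite_subset)
      moreover have "card (V - E \<sigma>) - 1 \<le> card (V - E \<sigma> - {x \<sigma>})"
        by (simp add: card_Diff_singleton_if)
      ultimately show ?thesis using E[OF s] by linarith
    qed
    then show ?thesis using sum_bounded_below[of B "card V - K - 1" "\<lambda>\<sigma>. card (V - E \<sigma> - {x \<sigma>})"] V fB
      by (simp add: P_def)
  qed
  ultimately show ?thesis by (simp add: B_def)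
qed

section \<open>Revealed darts and self-avoiding paths\<close>

lemma arr_in:
  assumes "\<sigma> \<in> perfect_matchings (mini_vertices n)" "n \<ge> 1"
  shows "arr \<sigma> w \<in> mini_vertices n"
proof (induction w)
  case Nil
  show ?case using assms(2) by (simp add: mini_vertices_eq)
next
  case (Cons c w)
  then show ?case using matching_apply(1)[OF assms(1)] by (simp add: nbd_in)
qed

lemma expl_properties:
  assumes "\<sigma> \<in> perfect_matchings (mini_vertices n)" "n \<ge> 1"
  shows "expl \<sigma> w \<subseteq> mini_vertices n \<and> \<sigma> ` expl \<sigma> w \<subseteq> expl \<sigma> w \<and> card (expl \<sigma> w) \<le> 2 * length w"
proof (induction w)
  case (Cons c w)
  have "card (expl \<sigma> (c # w)) \<le> card {nbd (arr \<sigma> w) c, \<sigma> (nbd (arr \<sigma> w) c)} + card (expl \<sigma> w)"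
    unfolding expl.simps by (rule card_Un_le)
  also have "card {nbd (arr \<sigma> w) c, \<sigma> (nbd (arr \<sigma> w) c)} \<le> 2"
    by (simp add: card_insert_if)
  finally show ?case
    using Cons arr_in[OF assms, of w] matching_apply[OF assms(1)] by (auto simp: nbd_in)
qed simp

text \<open>Following a path queries the matching only on the darts it reveals. This yields the
  hypothesis \<open>agree\<close> of \<open>card_matchings_hit\<close>.\<close>

lemma expl_agree:
  assumes "\<And>e. e \<in> expl \<sigma> w \<Longrightarrow> \<sigma>' e = \<sigma> e"
  shows "arr \<sigma>' w = arr \<sigma> w \<and> expl \<sigma>' w = expl \<sigma> w \<and> vis \<sigma>' w = vis \<sigma> w"
  using assms by (induction w) auto

lemma arr_in_vis: "arr \<sigma> w div 3 \<in> vis \<sigma> w"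
  by (cases w) auto

lemma expl_vis: "d \<in> expl \<sigma> w \<Longrightarrow> d div 3 \<in> vis \<sigma> w"
  using arr_in_vis[of \<sigma>] by (induction w) auto

lemma card_vis_le: "finite (vis \<sigma> w)" "card (vis \<sigma> w) \<le> Suc (length w)"
  by (induction w) (auto simp: card_insert_if)

text \<open>Every other revealed dart sits at an earlier vertex of the path, and self-avoidance
  keeps the end away from those.\<close>

lemma simple_word_unique:
  assumes "simple_word \<sigma> w" "d \<in> expl \<sigma> w" "d div 3 = arr \<sigma> w div 3"
  shows "d = arr \<sigma> w"
proof (cases w)
  case (Cons c u)
  then show ?thesis
    using assms expl_vis[of d \<sigma> u] arr_in_vis[of \<sigma> u] by auto
qed (use assms in simp)

text \<open>The departing dart lies at the end vertex and is not the arrival dart, since turns below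
  2 do not backtrack; \<open>simple_word_unique\<close> then makes it unrevealed. The empty path has
  revealed nothing.\<close>

lemma simple_word_fresh:
  assumes "simple_word \<sigma> w" "c # w \<in> nb_words m"
  shows "nbd (arr \<sigma> w) c \<notin> expl \<sigma> w"
proof (cases w)
  case (Cons d u)
  with assms(2) have "c < 2"
    by (auto elim!: Cons_in_nb_words split: if_splits)
  then show ?thesis
    using simple_word_unique[OF assms(1)] nbd_neq by force
qed simp

lemma darts_at:
  assumes "finite S"
  shows "finite {d::nat. d div 3 \<in> S}" "card {d::nat. d div 3 \<in> S} \<le> 3 * card S"
proof -
  have *: "{d::nat. d div 3 \<in> S} \<subseteq> (\<lambda>(v, r). 3 * v + r) ` (S \<times> {..<3})"
  proof
    fix d :: nat assume "d \<in> {d. d div 3 \<in> S}"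
    then show "d \<in> (\<lambda>(v, r). 3 * v + r) ` (S \<times> {..<3})"
      by (intro image_eqI[where x = "(d div 3, d mod 3)"]) auto
  qed
  then show "finite {d::nat. d div 3 \<in> S}"
    using assms by (auto intro: finite_subset)
  have "card {d::nat. d div 3 \<in> S} \<le> card ((\<lambda>(v, r). 3 * v + r) ` (S \<times> {..<3::nat}))"
    using assms * by (intro card_mono) auto
  also have "\<dots> \<le> card (S \<times> {..<3::nat})"
    using assms by (intro card_image_le) auto
  finally show "card {d::nat. d div 3 \<in> S} \<le> 3 * card S"
    by (simp add: card_cartesian_product)
qed

text \<open>Union bound over the steps: while the path is self-avoiding its next dart is unrevealed,
  and the step fails only if the partner is among the at most \<open>3 * Suc m\<close> darts at
  visited vertices.\<close>

lemma card_not_simple_word: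
  assumes "n \<ge> 1" "w \<in> nb_words m"
  defines "M \<equiv> perfect_matchings (mini_vertices n)"
  shows "card {\<sigma> \<in> M. \<not> simple_word \<sigma> w} * (3 * n - 2 * m) \<le> 3 * m * m * card M"
  using assms(2)
proof (induction m arbitrary: w)
  case 0
  then show ?case by simp
next
  case (Suc m)
  then obtain c u where w: "w = c # u" and u: "u \<in> nb_words m" "length u = m"
    by (auto simp add: nb_words.simps(2) length_nb_words)
  have fin: "finite M" by (simp add: M_def finite_perfect_matchings)
  let ?A = "{\<sigma> \<in> M. \<not> simple_word \<sigma> u}"
  let ?T = "\<lambda>\<sigma>. {d. d div 3 \<in> vis \<sigma> u}"
  let ?x = "\<lambda>\<sigma>. nbd (arr \<sigma> u) c"
  let ?B = "{\<sigma> \<in> M. ?x \<sigma> \<notin> expl \<sigma> u \<and> \<sigma> (?x \<sigma>) \<in> ?T \<sigma>}"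
  have "card ?B * (card (mini_vertices n) - 2 * m - 1) \<le> 3 * Suc m * card M"
    unfolding M_def
  proof (rule card_matchings_hit)
    fix \<sigma> assume s: "\<sigma> \<in> perfect_matchings (mini_vertices n)"
    show "expl \<sigma> u \<subseteq> mini_vertices n \<and> \<sigma> ` expl \<sigma> u \<subseteq> expl \<sigma> u \<and> card (expl \<sigma> u) \<le> 2 * m"
      using expl_properties[OF s assms(1), of u] u by simp
    show "?x \<sigma> \<in> mini_vertices n" using arr_in[OF s assms(1)] by (simp add: nbd_in)
    show "finite (?T \<sigma>) \<and> card (?T \<sigma>) \<le> 3 * Suc m"
      using darts_at[of "vis \<sigma> u"] card_vis_le[of \<sigma> u] u by auto
  next
    fix \<sigma> \<sigma>' assume "\<And>e. e \<in> expl \<sigma> u \<Longrightarrow> \<sigma>' e = \<sigma> e"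
    from expl_agree[of \<sigma> u \<sigma>', OF this]
    show "expl \<sigma>' u = expl \<sigma> u \<and> ?x \<sigma>' = ?x \<sigma> \<and> ?T \<sigma>' = ?T \<sigma>" by simp
  qed simp
  then have B: "card ?B * (3 * n - 2 * m - 1) \<le> 3 * Suc m * card M" by simp
  have "{\<sigma> \<in> M. \<not> simple_word \<sigma> w} \<subseteq> ?A \<union> ?B"
    using simple_word_fresh[OF _ Suc.prems[unfolded w]] unfolding w by simp blast
  then have "card {\<sigma> \<in> M. \<not> simple_word \<sigma> w} \<le> card (?A \<union> ?B)"
    using fin by (intro card_mono) simp_all
  also have "\<dots> \<le> card ?A + card ?B"
    by (rule card_Un_le)
  finally have "card {\<sigma> \<in> M. \<not> simple_word \<sigma> w} * (3 * n - 2 * Suc m)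
      \<le> (card ?A + card ?B) * (3 * n - 2 * Suc m)"
    by (rule mult_le_mono1)
  also have "\<dots> \<le> card ?A * (3 * n - 2 * m) + card ?B * (3 * n - 2 * m - 1)"
    unfolding add_mult_distrib by (intro add_mono mult_left_mono) auto
  also have "\<dots> \<le> 3 * m * m * card M + 3 * Suc m * card M"
    using Suc.IH[OF u(1)] B by linarith
  also have "\<dots> \<le> 3 * Suc m * Suc m * card M"
    by (simp add: algebra_simps)
  finally show ?case .
qed

text \<open>The last dart followed by \<open>w'\<close> is unrevealed: a self-avoiding \<open>w\<close> meets the vertex where it ends
  only in its arrival dart.\<close>

lemma card_distinct_arrivals:
  fixes T :: "nat \<Rightarrow> nat set"
  assumes "n \<ge> 1" "w \<in> nb_words m" "w' \<in> nb_words m"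
    and T: "\<And>g. finite (T g) \<and> card (T g) \<le> \<tau>"
  defines "M \<equiv> perfect_matchings (mini_vertices n)"
  shows "card {\<sigma> \<in> M. simple_word \<sigma> w \<and> simple_word \<sigma> w' \<and> arr \<sigma> w div 3 = arr \<sigma> w' div 3
      \<and> arr \<sigma> w \<noteq> arr \<sigma> w' \<and> arr \<sigma> w' \<in> T (arr \<sigma> w)} * (3 * n - 4 * m) \<le> \<tau> * card M"
    (is "card ?A * _ \<le> _")
proof (cases w')
  case Nil
  with assms(2,3) have "w = []" by (metis length_nb_words length_0_conv)
  with Nil have "?A = {}" by auto
  then show ?thesis by (simp only: card.empty)
next
  case (Cons c u)
  \<comment> \<open>All of \<open>w\<close> is revealed but \<open>w'\<close> only up to its last
    step, at most \<open>2 * m + 2 * (m - 1)\<close> darts. The last partner is then the random one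
    that has to hit \<open>T\<close>.\<close>
  let ?E = "\<lambda>\<sigma>. expl \<sigma> w \<union> expl \<sigma> u"
  let ?x = "\<lambda>\<sigma>. nbd (arr \<sigma> u) c"
  let ?B = "{\<sigma> \<in> M. ?x \<sigma> \<notin> ?E \<sigma> \<and> \<sigma> (?x \<sigma>) \<in> T (arr \<sigma> w)}"
  have l: "length w = m" "m = Suc (length u)"
    using assms(2,3) Cons by (auto dest: length_nb_words)
  have "card ?B * (card (mini_vertices n) - 4 * length u - 2 - 1) \<le> \<tau> * card M"
    unfolding M_def diff_diff_left
  proof (rule card_matchings_hit[where K = "4 * length u + 2", unfolded diff_diff_left])
    fix \<sigma> assume s: "\<sigma> \<in> perfect_matchings (mini_vertices n)"
    have "card (?E \<sigma>) \<le> card (expl \<sigma> w) + card (expl \<sigma> u)" by (rule card_Un_le)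
    then show "?E \<sigma> \<subseteq> mini_vertices n \<and> \<sigma> ` ?E \<sigma> \<subseteq> ?E \<sigma> \<and> card (?E \<sigma>) \<le> 4 * length u + 2"
      using expl_properties[OF s assms(1), of u] expl_properties[OF s assms(1), of w] l by auto
    show "?x \<sigma> \<in> mini_vertices n" using arr_in[OF s assms(1)] by (simp add: nbd_in)
    show "finite (T (arr \<sigma> w)) \<and> card (T (arr \<sigma> w)) \<le> \<tau>" by (rule T)
  next
    fix \<sigma> \<sigma>' assume "\<And>e. e \<in> ?E \<sigma> \<Longrightarrow> \<sigma>' e = \<sigma> e"
    then show "?E \<sigma>' = ?E \<sigma> \<and> ?x \<sigma>' = ?x \<sigma> \<and> T (arr \<sigma>' w) = T (arr \<sigma> w)"
      using expl_agree[of \<sigma> u \<sigma>'] expl_agree[of \<sigma> w \<sigma>'] by simp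
  qed simp
  moreover have "?A \<subseteq> ?B"
  proof
    fix \<sigma> assume A: "\<sigma> \<in> ?A"
    then have s: "\<sigma> \<in> perfect_matchings (mini_vertices n)" by (simp add: M_def)
    have "?x \<sigma> \<notin> expl \<sigma> u"
      using A assms(3) by (intro simple_word_fresh) (auto simp: Cons)
    moreover have "?x \<sigma> \<notin> expl \<sigma> w"
    proof
      assume "?x \<sigma> \<in> expl \<sigma> w"
      then have "arr \<sigma> w' \<in> expl \<sigma> w"
        using expl_properties[OF s assms(1), of w] by (auto simp: Cons)
      with A simple_word_unique[of \<sigma> w "arr \<sigma> w'"] show False by auto
    qed
    ultimately show "\<sigma> \<in> ?B" using A by (simp add: Cons)
  qed
  then have "card ?A \<le> card ?B"
    by (intro card_mono) (simp_all add: M_def finite_perfect_matchings)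
  then have "card ?A * (3 * n - 4 * m) \<le> card ?B * (3 * n - 4 * length u - 2 - 1)"
    using l by (intro mult_le_mono) auto
  ultimately show ?thesis by simp
qed

text \<open>As \<open>\<sigma>\<close> is injective, equal arrivals force equal last departures. If
  the last turns agree, the shorter paths already share their arrival, which is the induction. If
  they differ, the shorter paths end at one vertex through different darts, and the second arrival
  is determined by the first, so a single dart has to be hit.\<close>

lemma card_same_arrival:
  assumes "n \<ge> 1" "w \<in> nb_words m" "w' \<in> nb_words m" "w \<noteq> w'"
  defines "M \<equiv> perfect_matchings (mini_vertices n)"
  shows "card {\<sigma> \<in> M. simple_word \<sigma> w \<and> simple_word \<sigma> w' \<and> arr \<sigma> w = arr \<sigma> w'} * (3 * n - 4 * m) \<le> card M"
  using assms(2-4)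
proof (induction m arbitrary: w w')
  case 0
  then show ?case by simp
next
  case (Suc m)
  let ?A = "\<lambda>w w'. {\<sigma> \<in> M. simple_word \<sigma> w \<and> simple_word \<sigma> w' \<and> arr \<sigma> w = arr \<sigma> w'}"
  have fin: "finite M" by (simp add: M_def finite_perfect_matchings)
  have decompose: "\<exists>c u. v = c # u \<and> u \<in> nb_words m \<and> c < 3" if "v \<in> nb_words (Suc m)" for v
    using that by (auto simp add: nb_words.simps(2) split: if_splits)
  obtain c u where wu: "w = c # u" "u \<in> nb_words m" "c < 3"
    using decompose[OF Suc.prems(1)] by blast
  obtain c' u' where wu': "w' = c' # u'" "u' \<in> nb_words m" "c' < 3"
    using decompose[OF Suc.prems(2)] by blast
  note w = wu(1) wu'(1) and u = wu(2) wu'(2) and c = wu(3) wu'(3)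
  have inj: "nbd (arr \<sigma> u) c = nbd (arr \<sigma> u') c'" if "\<sigma> \<in> ?A w w'" for \<sigma>
    using that matching_apply(5) by (auto simp: w M_def)
  show ?case
  proof (cases "c = c'")
    case True
    then have "?A w w' \<subseteq> ?A u u'"
      using inj nbd_inject_left by (auto simp: w)
    then have "card (?A w w') \<le> card (?A u u')"
      using fin by (intro card_mono) auto
    then have "card (?A w w') * (3 * n - 4 * Suc m) \<le> card (?A u u') * (3 * n - 4 * m)"
      by (intro mult_le_mono) auto
    also have "\<dots> \<le> card M"
      using Suc.prems True by (intro Suc.IH u) (auto simp: w)
    finally show ?thesis .
  next
    case False
    let ?T = "\<lambda>g. {g'. nbd g' c' = nbd g c}"
    let ?B = "{\<sigma> \<in> M. simple_word \<sigma> u \<and> simple_word \<sigma> u' \<and> arr \<sigma> u div 3 = arr \<sigma> u' div 3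
      \<and> arr \<sigma> u \<noteq> arr \<sigma> u' \<and> arr \<sigma> u' \<in> ?T (arr \<sigma> u)}"
    have T: "finite (?T g) \<and> card (?T g) \<le> 1" for g
    proof (cases "?T g = {}")
      case True
      then show ?thesis by (simp only: card.empty finite.emptyI zero_le simp_thms)
    next
      case False
      then obtain h where h: "nbd h c' = nbd g c" by blast
      have sub: "?T g \<subseteq> {h}"
      proof
        fix g' assume "g' \<in> ?T g"
        then have "nbd g' c' = nbd h c'" unfolding h by (rule CollectD)
        then have "g' = h" by (rule nbd_inject_left)
        then show "g' \<in> {h}" by blast
      qed
      then have "finite (?T g)" by (rule finite_subset) simp
      moreover have "card (?T g) \<le> card {h}" by (rule card_mono[OF _ sub]) simp
      ultimately show ?thesis by simp
    qed
    have "?A w w' \<subseteq> ?B"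
    proof
      fix \<sigma> assume A: "\<sigma> \<in> ?A w w'"
      from inj[OF A] have "arr \<sigma> u div 3 = arr \<sigma> u' div 3" by (metis nbd_div)
      moreover have "arr \<sigma> u \<noteq> arr \<sigma> u'"
        using inj[OF A] False c nbd_inject by metis
      ultimately show "\<sigma> \<in> ?B" using A inj[OF A] by (auto simp: w)
    qed
    then have "card (?A w w') \<le> card ?B"
      using fin by (intro card_mono) auto
    then have "card (?A w w') * (3 * n - 4 * Suc m) \<le> card ?B * (3 * n - 4 * m)"
      by (intro mult_le_mono) auto
    also have "\<dots> \<le> 1 * card M"
      unfolding M_def by (rule card_distinct_arrivals[OF assms(1) u T])
    finally show ?thesis by simp
  qed
qed

text \<open>The factor 3 is one for arrival through the same dart plus two for the other darts at
  the common end.\<close>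

lemma card_same_end:
  assumes "n \<ge> 1" "w \<in> nb_words m" "w' \<in> nb_words m" "w \<noteq> w'"
  defines "M \<equiv> perfect_matchings (mini_vertices n)"
  shows "card {\<sigma> \<in> M. simple_word \<sigma> w \<and> simple_word \<sigma> w' \<and> arr \<sigma> w div 3 = arr \<sigma> w' div 3} * (3 * n - 4 * m)
    \<le> 3 * card M" (is "card ?A * _ \<le> _")
proof -
  let ?T = "\<lambda>g::nat. {d::nat. d div 3 \<in> {g div 3}} - {g}"
  let ?B = "{\<sigma> \<in> M. simple_word \<sigma> w \<and> simple_word \<sigma> w' \<and> arr \<sigma> w = arr \<sigma> w'}"
  let ?C = "{\<sigma> \<in> M. simple_word \<sigma> w \<and> simple_word \<sigma> w' \<and> arr \<sigma> w div 3 = arr \<sigma> w' div 3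
      \<and> arr \<sigma> w \<noteq> arr \<sigma> w' \<and> arr \<sigma> w' \<in> ?T (arr \<sigma> w)}"
  have fin: "finite M" by (simp add: M_def finite_perfect_matchings)
  have "finite (?T g) \<and> card (?T g) \<le> 2" for g
    using darts_at[of "{g div 3}"] by (simp add: card_Diff_singleton_if)
  then have C: "card ?C * (3 * n - 4 * m) \<le> 2 * card M"
    unfolding M_def by (intro card_distinct_arrivals assms)
  have B: "card ?B * (3 * n - 4 * m) \<le> card M"
    unfolding M_def by (intro card_same_arrival assms)
  have "card ?A \<le> card (?B \<union> ?C)"
    using fin by (intro card_mono) auto
  also have "\<dots> \<le> card ?B + card ?C" by (rule card_Un_le)
  finally have "card ?A * (3 * n - 4 * m) \<le> (card ?B + card ?C) * (3 * n - 4 * m)"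
    by (intro mult_le_mono) auto
  with B C show ?thesis by (simp add: add_mult_distrib)
qed

lemma sum_nb_words_Suc:
  "(\<Sum>w\<in>nb_words (Suc m). F w) = (\<Sum>u\<in>nb_words m. \<Sum>c<(if m = 0 then 3 else 2). F (c # u))"
proof -
  have "inj_on (\<lambda>(c, w). c # w) ({..<if m = 0 then 3 else 2::nat} \<times> nb_words m)"
    by (auto intro: inj_onI)
  then have "(\<Sum>w\<in>nb_words (Suc m). F w) = (\<Sum>(c, u)\<in>{..<if m = 0 then 3 else 2} \<times> nb_words m. F (c # u))"
    unfolding nb_words.simps(2) by (subst sum.reindex) (simp_all add: case_prod_unfold o_def)
  also have "\<dots> = (\<Sum>c<(if m = 0 then 3 else 2). \<Sum>u\<in>nb_words m. F (c # u))"
    by (rule sum.cartesian_product[symmetric])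
  also have "\<dots> = (\<Sum>u\<in>nb_words m. \<Sum>c<(if m = 0 then 3 else 2). F (c # u))"
    by (rule sum.swap)
  finally show ?thesis .
qed

section \<open>Reduction of the walk to non-backtracking paths\<close>

lemma sum_lessThan_2_3:
  fixes F :: "nat \<Rightarrow> real"
  shows "(\<Sum>i<2. F i) = F 0 + F 1" "(\<Sum>i<3. F i) = F 0 + F 1 + F 2"
  by (simp_all add: lessThan_nat_numeral lessThan_Suc add_ac)

lemma sum_darts:
  fixes F :: "nat \<Rightarrow> real"
  shows "(\<Sum>i<3. F (3 * (g div 3) + i)) = F g + (\<Sum>c<2. F (nbd g c))"
proof -
  have "g = 3 * (g div 3) + g mod 3" by simp
  then have "F g = F (3 * (g div 3) + g mod 3)" by (rule arg_cong)
  then show ?thesis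
    unfolding nbd_def sum_lessThan_2_3 using mod_3_cases[of g] by (elim disjE) simp_all
qed

definition nb_avg :: "(nat \<Rightarrow> nat) \<Rightarrow> (nat \<Rightarrow> real) \<Rightarrow> nat \<Rightarrow> real" where
  "nb_avg \<sigma> f m = (\<Sum>w\<in>nb_words m. f (arr \<sigma> w div 3)) / card (nb_words m)"

definition walk_step :: "(nat \<Rightarrow> nat) \<Rightarrow> (nat \<Rightarrow> real) \<Rightarrow> nat \<Rightarrow> real" where
  "walk_step \<sigma> f v = (\<Sum>i<3. f (\<sigma> (3 * v + i) div 3)) / 3"

text \<open>Transition operator for the distance from the root of simple random walk on the
  3-regular tree: outwards with probability \<open>2/3\<close>, inwards with \<open>1/3\<close>,
  always outwards at the root.\<close>

definition radial_step :: "(nat \<Rightarrow> real) \<Rightarrow> nat \<Rightarrow> real" where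
  "radial_step g m = (if m = 0 then g 1 else (2 * g (m + 1) + g (m - 1)) / 3)"

lemma card_nb_words_pos: "card (nb_words m) > 0"
  using card_nb_words_ge[of m] zero_less_power[of "2::nat" m] by linarith

text \<open>At the end of a non-empty path one of the three darts goes back and deletes the last
  turn, the other two append a turn. Both operations keep the path uniform, so only its length
  moves, by a rule that does not involve the matching.\<close>

lemma nb_avg_walk_step:
  assumes "\<sigma> \<in> perfect_matchings V"
  shows "nb_avg \<sigma> (walk_step \<sigma> f) m = radial_step (nb_avg \<sigma> f) m"
proof (cases m)
  case 0
  have "nbd 5 c = 3 + c" if "c < 3" for c
    using that unfolding less_3_cases by (elim disjE) (simp_all add: nbd_def)
  then have "(\<Sum>i<3. f (\<sigma> (3 + i) div 3)) = (\<Sum>i<3. f (\<sigma> (nbd 5 i) div 3))"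
    by (intro sum.cong) auto
  then show ?thesis
    using 0 card_nb_words[of 0]
    by (simp add: nb_avg_def walk_step_def radial_step_def sum_nb_words_Suc)
next
  case (Suc k)
  let ?q = "if k = 0 then 3 else 2 :: nat"
  let ?F = "\<lambda>w. f (arr \<sigma> w div 3)"
  have "3 * walk_step \<sigma> f (arr \<sigma> (c # u) div 3) = ?F u + (\<Sum>b<2. ?F (b # c # u))" for c u
    using sum_darts[of "\<lambda>d. f (\<sigma> d div 3)" "arr \<sigma> (c # u)"] matching_apply(3)[OF assms]
    by (simp add: walk_step_def)
  then have "3 * (\<Sum>w\<in>nb_words (Suc k). walk_step \<sigma> f (arr \<sigma> w div 3)) =
      (\<Sum>u\<in>nb_words k. \<Sum>c<?q. ?F u + (\<Sum>b<2. ?F (b # c # u)))"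
    unfolding sum_nb_words_Suc sum_distrib_left by simp
  \<comment> \<open>Each path of length \<open>k\<close> has \<open>?q\<close> extensions by one
    turn and so arises \<open>?q\<close> times by deletion.\<close>
  also have "\<dots> = ?q * (\<Sum>u\<in>nb_words k. ?F u) + (\<Sum>w\<in>nb_words (Suc (Suc k)). ?F w)"
    unfolding sum_nb_words_Suc[of _ "Suc k"] unfolding sum_nb_words_Suc[of _ k]
    by (simp add: sum.distrib sum_distrib_left)
  finally have "3 * (\<Sum>w\<in>nb_words (Suc k). walk_step \<sigma> f (arr \<sigma> w div 3)) =
    ?q * (\<Sum>u\<in>nb_words k. ?F u) + (\<Sum>w\<in>nb_words (Suc (Suc k)). ?F w)" .
  moreover have "card (nb_words (Suc (Suc k))) = 2 * card (nb_words (Suc k))"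
    "card (nb_words (Suc k)) = ?q * card (nb_words k)"
    by (simp_all add: card_nb_words_Suc)
  ultimately show ?thesis
    using card_nb_words_pos[of k]
    by (simp add: Suc nb_avg_def radial_step_def field_simps)
qed

section \<open>The chain of path lengths and its concentration\<close>

text \<open>Expectation of \<open>g\<close> at time \<open>k\<close> for the chain started at 0.
  Letting the transition operator act on the function avoids constructing the chain as a random
  process.\<close>

primrec radial_exp :: "nat \<Rightarrow> (nat \<Rightarrow> real) \<Rightarrow> real" where
  "radial_exp 0 g = g 0"
| "radial_exp (Suc k) g = radial_exp k (radial_step g)"

lemma walk_step_funpow:
  assumes "\<sigma> \<in> perfect_matchings V"
  shows "(walk_step \<sigma> ^^ k) f 1 = radial_exp k (nb_avg \<sigma> f)"
proof (induction k arbitrary: f)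
  case 0
  show ?case by (simp add: nb_avg_def)
next
  case (Suc k)
  have "(walk_step \<sigma> ^^ Suc k) f 1 = (walk_step \<sigma> ^^ k) (walk_step \<sigma> f) 1"
    by (simp add: funpow_swap1)
  also have "\<dots> = radial_exp k (\<lambda>m. radial_step (nb_avg \<sigma> f) m)"
    unfolding Suc.IH nb_avg_walk_step[OF assms, symmetric] ..
  finally show ?case by simp
qed

lemma radial_exp_mono: "(\<And>m. g m \<le> h m) \<Longrightarrow> radial_exp k g \<le> radial_exp k h"
proof (induction k arbitrary: g h)
  case (Suc k)
  have "radial_step g m \<le> radial_step h m" for m
    using Suc.prems by (simp add: radial_step_def add_mono)
  then show ?case using Suc.IH by simp
qed simp

lemma radial_exp_affine: "radial_exp k (\<lambda>m. a * g m + b) = a * radial_exp k g + b"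
proof (induction k arbitrary: g)
  case (Suc k)
  have "radial_step (\<lambda>m. a * g m + b) = (\<lambda>m. a * radial_step g m + b)"
    by (auto simp: radial_step_def fun_eq_iff field_simps)
  then show ?case using Suc.IH by simp
qed simp

lemma radial_exp_sum: "radial_exp k (\<lambda>m. \<Sum>s\<in>A. g s m) = (\<Sum>s\<in>A. radial_exp k (g s))"
proof (induction k arbitrary: g)
  case (Suc k)
  have "radial_step (\<lambda>m. \<Sum>s\<in>A. g s m) = (\<lambda>m. \<Sum>s\<in>A. radial_step (g s) m)"
    by (rule ext) (simp add: radial_step_def sum_distrib_left sum.distrib flip: sum_divide_distrib)
  then show ?case using Suc.IH by simp
qed simp

text \<open>No estimate of the time spent at 0 is needed, since the reflection there does not
  increase the second moment about \<open>k / 3\<close> by more than the other steps.\<close>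

lemma radial_exp_variance: "radial_exp k (\<lambda>m. (real m - k / 3)\<^sup>2) \<le> k"
proof (induction k)
  case (Suc k)
  \<comment> \<open>Away from 0 the drift \<open>1/3\<close> cancels the shift of the centre and the
    increment has variance \<open>8/9\<close>. At 0 the new value is
    \<open>(2 - k)\<^sup>2 / 9\<close>, which exceeds \<open>k\<^sup>2 / 9\<close> by at most
    \<open>4/9\<close>.\<close>
  have "radial_step (\<lambda>m. (real m - Suc k / 3)\<^sup>2) m \<le> 1 * (real m - k / 3)\<^sup>2 + 1" for m
  proof (cases m)
    case 0
    then show ?thesis by (simp add: radial_step_def power2_eq_square field_simps)
  next
    case (Suc i)
    then show ?thesis by (simp add: radial_step_def power2_eq_square field_simps)
  qed
  then have "radial_exp (Suc k) (\<lambda>m. (real m - Suc k / 3)\<^sup>2) \<le> 1 * radial_exp k (\<lambda>m. (real m - k / 3)\<^sup>2) + 1"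
    unfolding radial_exp.simps radial_exp_affine[symmetric] by (intro radial_exp_mono)
  then show ?case using Suc.IH by simp
qed simp

text \<open>Chebyshev's inequality: \<open>g\<close> is dominated pointwise by
  \<open>\<eta> + (m - k / 3)\<^sup>2 / \<Delta>\<^sup>2\<close>.\<close>

lemma radial_exp_concentration:
  assumes "\<Delta> > 0" "\<eta> \<ge> 0" "\<And>m. g m \<le> 1" "\<And>m. \<bar>real m - k / 3\<bar> \<le> \<Delta> \<Longrightarrow> g m \<le> \<eta>"
  shows "radial_exp k g \<le> \<eta> + k / \<Delta>\<^sup>2"
proof -
  have "g m \<le> (1 / \<Delta>\<^sup>2) * (real m - k / 3)\<^sup>2 + \<eta>" for m
  proof (cases "\<bar>real m - k / 3\<bar> \<le> \<Delta>")
    case True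
    have "0 \<le> (1 / \<Delta>\<^sup>2) * (real m - k / 3)\<^sup>2" by simp
    with assms(4)[OF True] show ?thesis by linarith
  next
    case False
    then have "\<Delta>\<^sup>2 \<le> (real m - k / 3)\<^sup>2"
      using assms(1) by (intro abs_le_square_iff[THEN iffD1]) auto
    then have "1 \<le> (1 / \<Delta>\<^sup>2) * (real m - k / 3)\<^sup>2" using assms(1) by simp
    then show ?thesis using assms(2) assms(3)[of m] by linarith
  qed
  then have "radial_exp k g \<le> (1 / \<Delta>\<^sup>2) * radial_exp k (\<lambda>m. (real m - k / 3)\<^sup>2) + \<eta>"
    unfolding radial_exp_affine[symmetric] by (rule radial_exp_mono)
  also have "\<dots> \<le> (1 / \<Delta>\<^sup>2) * k + \<eta>"
    using radial_exp_variance by (intro add_mono mult_left_mono) auto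
  finally show ?thesis by simp
qed

section \<open>Graph distance\<close>

lemma graph_dist_arr_le:
  assumes "\<sigma> \<in> perfect_matchings (mini_vertices n)" "n \<ge> 1"
  shows "graph_dist (cubic_graph n \<sigma>) (arr \<sigma> w div 3) 1 \<le> ereal (length w)"
proof -
  interpret bidirected_digraph "cubic_graph n \<sigma>" \<sigma>
    by (rule bidirected_cubic_graph) fact
  have "\<exists>p. awalk (arr \<sigma> w div 3) p 1 \<and> length p = length w"
  proof (induction w)
    case Nil
    have "1 \<in> verts (cubic_graph n \<sigma>)" using assms(2) by (simp add: cubic_graph_def)
    then show ?case by (auto simp: awalk_Nil_iff)
  next
    case (Cons c w)
    then obtain p where p: "awalk (arr \<sigma> w div 3) p 1" "length p = length w" by blast
    \<comment> \<open>The path is run backwards: the arc \<open>arr \<sigma> (c # w)\<close> starts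
      at the new end, and its partner is the departing dart at the end of \<open>w\<close>.\<close>
    have "awalk (arr \<sigma> (c # w) div 3) (arr \<sigma> (c # w) # p) 1"
      unfolding awalk_Cons_iff using p(1) arr_in[OF assms, of "c # w"] matching_apply(3)[OF assms(1)]
      by (simp add: cubic_graph_def)
    with p(2) show ?case by (intro exI conjI) auto
  qed
  then obtain p where p: "awalk (arr \<sigma> w div 3) p 1" "length p = length w" by blast
  have "awalk_cost (\<lambda>_. 1) p = length p"
    by (simp add: awalk_cost_def sum_list_triv)
  with min_cost_le_walk_cost[OF p(1), of "\<lambda>_. 1"] p(2) show ?thesis
    by (simp add: graph_dist_def)
qed

text \<open>Every walk reduces to a non-backtracking path that is no longer. Its arcs are added from
  the root outwards: an arc that reverses the last step cancels it, any other one appends a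
  turn.\<close>

lemma nb_word_of_graph_dist:
  assumes "\<sigma> \<in> perfect_matchings (mini_vertices n)"
    and "graph_dist (cubic_graph n \<sigma>) v 1 < ereal x"
  shows "\<exists>j w. w \<in> nb_words j \<and> real j < x \<and> arr \<sigma> w div 3 = v"
proof -
  interpret bidirected_digraph "cubic_graph n \<sigma>" \<sigma>
    by (rule bidirected_cubic_graph) fact
  have tail_head: "tail (cubic_graph n \<sigma>) e = e div 3" "head (cubic_graph n \<sigma>) e = \<sigma> e div 3" for e
    by (simp_all add: cubic_graph_def)
  have "\<exists>j\<le>length p. \<exists>w\<in>nb_words j. arr \<sigma> w div 3 = v" if "awalk v p 1" for v p
    using that
  proof (induction p arbitrary: v)
    case Nil
    then show ?case by (auto simp: awalk_Nil_iff)
  next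
    case (Cons e p)
    then have v: "v = e div 3" "awalk (\<sigma> e div 3) p 1"
      unfolding awalk_Cons_iff by (simp_all add: tail_head)
    obtain j w where w: "j \<le> length p" "w \<in> nb_words j" "arr \<sigma> w div 3 = \<sigma> e div 3"
      using Cons.IH[OF v(2)] by blast
    note inv = matching_apply(3)[OF assms(1)]
    consider (root) "w = []" | (backward) c u where "w = c # u" "\<sigma> e = arr \<sigma> w"
      | (forward) "w \<noteq> []" "\<sigma> e \<noteq> arr \<sigma> w"
      by (cases w) auto
    then show ?case
    proof cases
      case root
      have "\<sigma> e div 3 = 1" using w(3) root by simp
      \<comment> \<open>The turn from the dart 5 to a dart at vertex 1 is the residue of that dart
        modulo 3.\<close>
      then have d: "\<sigma> e = nbd 5 (\<sigma> e mod 3)"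
        using mod_3_cases[of "\<sigma> e"] mult_div_mod_eq[of 3 "\<sigma> e"]
        by (elim disjE) (simp_all add: nbd_def)
      then have "arr \<sigma> [\<sigma> e mod 3] = e" using inv[of e] by simp
      moreover have "[\<sigma> e mod 3] \<in> nb_words (Suc 0)" by (auto simp: nb_words.simps(2))
      ultimately show ?thesis using v(1)
        by (intro exI[of _ "Suc 0"] conjI bexI[of _ "[\<sigma> e mod 3]"]) simp_all
    next
      case backward
      then have "e = nbd (arr \<sigma> u) c" using inv by (metis arr.simps(2))
      then have "arr \<sigma> u div 3 = v" using v(1) by simp
      moreover obtain j' where "j = Suc j'" "u \<in> nb_words j'"
        using w(2) backward(1) Cons_in_nb_words by metis
      ultimately show ?thesis using w(1) by (intro exI[of _ j']) auto
    next
      case forward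
      then obtain c where c: "c < 2" "\<sigma> e = nbd (arr \<sigma> w) c"
        using ex_nbd w(3) by metis
      then have "arr \<sigma> (c # w) = e" using inv by (metis arr.simps(2))
      moreover have "c # w \<in> nb_words (Suc j)"
        using w(2) c(1) by (auto simp add: nb_words.simps(2))
      ultimately show ?thesis using v(1) w(1)
        by (intro exI[of _ "Suc j"] conjI bexI[of _ "c # w"]) simp_all
    qed
  qed
  moreover obtain p where "awalk v p 1" "awalk_cost (\<lambda>_. 1) p < x"
    using assms(2) by (auto simp: graph_dist_def \<mu>_def INF_less_iff)
  moreover have "awalk_cost (\<lambda>_. 1) p = length p"
    by (simp add: awalk_cost_def sum_list_triv)
  ultimately show ?thesis by fastforce
qed

section \<open>Second moment\<close>

text \<open>The restricted endpoint law \<open>q\<^sub>m\<close>. Words that hit themselves are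
  dropped because the collision estimate covers only self-avoiding paths, so the total mass may be
  below 1.\<close>

definition simple_frac :: "nat \<Rightarrow> (nat \<Rightarrow> nat) \<Rightarrow> nat \<Rightarrow> real" where
  "simple_frac m \<sigma> v =
     (\<Sum>w\<in>nb_words m. of_bool (simple_word \<sigma> w \<and> arr \<sigma> w div 3 = v)) / card (nb_words m)"

lemma of_nat_card_filter:
  "finite A \<Longrightarrow> real (card {x \<in> A. P x}) = (\<Sum>x\<in>A. of_bool (P x))"
  by (simp add: of_bool_def sum.If_cases Int_def)

text \<open>Expanding the square turns the sum over vertices into a count of pairs of words with a
  common end. Equal words account for the first summand, \<open>card_same_end\<close> bounds all
  other pairs.\<close>

lemma simple_frac_second_moment:
  assumes "n \<ge> 1" "4 * m < 3 * n"
  defines "M \<equiv> perfect_matchings (mini_vertices n)"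
  shows "(\<Sum>\<sigma>\<in>M. \<Sum>v\<in>{1..n}. (simple_frac m \<sigma> v)\<^sup>2)
    \<le> card M * (1 / card (nb_words m) + 3 / (3 * real n - 4 * real m))"
proof -
  let ?W = "nb_words m" and ?r = "3 * real n - 4 * real m"
  let ?J = "\<lambda>\<sigma> w w'. simple_word \<sigma> w \<and> simple_word \<sigma> w' \<and> arr \<sigma> w div 3 = arr \<sigma> w' div 3"
  define I where "I \<sigma> v w = (of_bool (simple_word \<sigma> w \<and> arr \<sigma> w div 3 = v) :: real)" for \<sigma> v w
  have fin: "finite M" by (simp add: M_def finite_perfect_matchings)
  have finW: "finite ?W" by (rule finite_nb_words)
  have r: "?r > 0" using assms(2) by linarith
  have vsum: "(\<Sum>v\<in>{1..n}. I \<sigma> v w * I \<sigma> v w') \<le> of_bool (?J \<sigma> w w')" for \<sigma> w w'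
  proof -
    have "(\<Sum>v\<in>{1..n}. I \<sigma> v w * I \<sigma> v w') =
        (\<Sum>v\<in>{1..n}. if arr \<sigma> w div 3 = v then of_bool (?J \<sigma> w w') else 0)"
      by (intro sum.cong) (auto simp: I_def)
    also have "\<dots> \<le> of_bool (?J \<sigma> w w')" by simp
    finally show ?thesis .
  qed
  have pair: "(\<Sum>\<sigma>\<in>M. of_bool (?J \<sigma> w w')) \<le> (if w = w' then real (card M) else 0) + 3 * card M / ?r"
    if "w \<in> ?W" "w' \<in> ?W" for w w'
  proof (cases "w = w'")
    case True
    have "(\<Sum>\<sigma>\<in>M. of_bool (?J \<sigma> w w')) \<le> real (card M) * 1"
      by (intro sum_bounded_above) simp
    with True r show ?thesis by (simp add: add_increasing2)
  next
    case False
    have "card {\<sigma> \<in> M. ?J \<sigma> w w'} * (3 * n - 4 * m) \<le> 3 * card M"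
      unfolding M_def using assms(1) that False by (rule card_same_end)
    then have "real (card {\<sigma> \<in> M. ?J \<sigma> w w'} * (3 * n - 4 * m)) \<le> real (3 * card M)"
      by (rule of_nat_mono)
    then have "real (card {\<sigma> \<in> M. ?J \<sigma> w w'}) * ?r \<le> 3 * card M"
      using assms(2) by (simp add: of_nat_diff)
    with r False show ?thesis
      by (simp add: of_nat_card_filter[OF fin] pos_le_divide_eq)
  qed
  have "(\<Sum>v\<in>{1..n}. (\<Sum>w\<in>?W. I \<sigma> v w)\<^sup>2) \<le> (\<Sum>w\<in>?W. \<Sum>w'\<in>?W. of_bool (?J \<sigma> w w'))" for \<sigma>
  proof -
    have "(\<Sum>v\<in>{1..n}. (\<Sum>w\<in>?W. I \<sigma> v w)\<^sup>2) = (\<Sum>v\<in>{1..n}. \<Sum>w\<in>?W. \<Sum>w'\<in>?W. I \<sigma> v w * I \<sigma> v w')"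
      by (simp add: power2_eq_square sum_product)
    also have "\<dots> = (\<Sum>w\<in>?W. \<Sum>v\<in>{1..n}. \<Sum>w'\<in>?W. I \<sigma> v w * I \<sigma> v w')"
      by (rule sum.swap)
    also have "\<dots> = (\<Sum>w\<in>?W. \<Sum>w'\<in>?W. \<Sum>v\<in>{1..n}. I \<sigma> v w * I \<sigma> v w')"
      by (rule sum.cong[OF refl], rule sum.swap)
    also have "\<dots> \<le> (\<Sum>w\<in>?W. \<Sum>w'\<in>?W. of_bool (?J \<sigma> w w'))"
      by (intro sum_mono vsum)
    finally show ?thesis .
  qed
  then have "(\<Sum>\<sigma>\<in>M. \<Sum>v\<in>{1..n}. (\<Sum>w\<in>?W. I \<sigma> v w)\<^sup>2)
      \<le> (\<Sum>\<sigma>\<in>M. \<Sum>w\<in>?W. \<Sum>w'\<in>?W. of_bool (?J \<sigma> w w'))"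
    by (rule sum_mono)
  also have "\<dots> = (\<Sum>w\<in>?W. \<Sum>\<sigma>\<in>M. \<Sum>w'\<in>?W. of_bool (?J \<sigma> w w'))"
    by (rule sum.swap)
  also have "\<dots> = (\<Sum>w\<in>?W. \<Sum>w'\<in>?W. \<Sum>\<sigma>\<in>M. of_bool (?J \<sigma> w w'))"
    by (rule sum.cong[OF refl], rule sum.swap)
  also have "\<dots> \<le> (\<Sum>w\<in>?W. \<Sum>w'\<in>?W. (if w = w' then real (card M) else 0) + 3 * card M / ?r)"
    by (intro sum_mono pair)
  also have "\<dots> = real (card ?W) * card M + (real (card ?W))\<^sup>2 * (3 * card M / ?r)"
    using finW by (simp add: sum.distrib power2_eq_square distrib_left mult.assoc)
  finally have *: "(\<Sum>\<sigma>\<in>M. \<Sum>v\<in>{1..n}. (\<Sum>w\<in>?W. I \<sigma> v w)\<^sup>2)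
    \<le> real (card ?W) * card M + (real (card ?W))\<^sup>2 * (3 * card M / ?r)" .
  have "(\<Sum>\<sigma>\<in>M. \<Sum>v\<in>{1..n}. (simple_frac m \<sigma> v)\<^sup>2)
      = (\<Sum>\<sigma>\<in>M. \<Sum>v\<in>{1..n}. (\<Sum>w\<in>?W. I \<sigma> v w)\<^sup>2) / (real (card ?W))\<^sup>2"
    by (simp add: simple_frac_def I_def power_divide flip: sum_divide_distrib)
  also have "\<dots> \<le> (real (card ?W) * card M + (real (card ?W))\<^sup>2 * (3 * card M / ?r)) / (real (card ?W))\<^sup>2"
    using * by (rule divide_right_mono) simp
  also have "\<dots> = card M * (1 / card ?W + 3 / ?r)"
    using card_nb_words_pos[of m] r by (simp add: field_simps power2_eq_square)
  finally show ?thesis .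
qed

text \<open>Here \<open>b\<close> bounds the average size of a set that may depend on the matching.
  Words that hit themselves contribute the first term; for the others Cauchy-Schwarz combines the
  size of the set with the second moment.\<close>

lemma nb_avg_indicator_bound:
  fixes B :: "(nat \<Rightarrow> nat) \<Rightarrow> nat set" and b :: real
  assumes "n \<ge> 1" "4 * m < 3 * n"
  defines "M \<equiv> perfect_matchings (mini_vertices n)"
  assumes B: "\<And>\<sigma>. \<sigma> \<in> M \<Longrightarrow> B \<sigma> \<subseteq> {1..n}" and "(\<Sum>\<sigma>\<in>M. real (card (B \<sigma>))) \<le> b * card M"
  shows "(\<Sum>\<sigma>\<in>M. nb_avg \<sigma> (indicator (B \<sigma>)) m) \<le> card M *
    (3 * (real m)\<^sup>2 / (3 * real n - 2 * real m) + sqrt (b * (1 / card (nb_words m) + 3 / (3 * real n - 4 * real m))))"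
proof -
  let ?W = "nb_words m" and ?r = "3 * real n - 2 * real m"
  let ?\<beta> = "1 / card ?W + 3 / (3 * real n - 4 * real m)"
  have fin: "finite M" by (simp add: M_def finite_perfect_matchings)
  have finW: "finite ?W" by (rule finite_nb_words)
  have finB: "finite (B \<sigma>)" if "\<sigma> \<in> M" for \<sigma> using B[OF that] finite_subset by blast
  have r: "?r > 0" using assms(2) by linarith
  have split: "nb_avg \<sigma> (indicator (B \<sigma>)) m
      \<le> (\<Sum>w\<in>?W. of_bool (\<not> simple_word \<sigma> w)) / card ?W + (\<Sum>v\<in>B \<sigma>. simple_frac m \<sigma> v)"
    if "\<sigma> \<in> M" for \<sigma>
  proof -
    have "(\<Sum>v\<in>B \<sigma>. \<Sum>w\<in>?W. of_bool (simple_word \<sigma> w \<and> arr \<sigma> w div 3 = v))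
        = (\<Sum>w\<in>?W. \<Sum>v\<in>B \<sigma>. if arr \<sigma> w div 3 = v then of_bool (simple_word \<sigma> w) else 0 :: real)"
      by (subst sum.swap) (intro sum.cong refl, auto)
    also have "\<dots> = (\<Sum>w\<in>?W. of_bool (simple_word \<sigma> w \<and> arr \<sigma> w div 3 \<in> B \<sigma>))"
      using finB[OF that] by (intro sum.cong refl) auto
    finally have *: "(\<Sum>v\<in>B \<sigma>. simple_frac m \<sigma> v)
        = (\<Sum>w\<in>?W. of_bool (simple_word \<sigma> w \<and> arr \<sigma> w div 3 \<in> B \<sigma>)) / card ?W"
      by (simp add: simple_frac_def flip: sum_divide_distrib)
    have "(\<Sum>w\<in>?W. indicator (B \<sigma>) (arr \<sigma> w div 3) :: real)
        \<le> (\<Sum>w\<in>?W. of_bool (\<not> simple_word \<sigma> w) + of_bool (simple_word \<sigma> w \<and> arr \<sigma> w div 3 \<in> B \<sigma>))"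
      by (intro sum_mono) (auto simp: indicator_def)
    then show ?thesis
      unfolding * nb_avg_def sum.distrib add_divide_distrib[symmetric]
      by (rule divide_right_mono) simp
  qed
  have "(\<Sum>\<sigma>\<in>M. of_bool (\<not> simple_word \<sigma> w)) \<le> 3 * (real m)\<^sup>2 * card M / ?r" if "w \<in> ?W" for w
  proof -
    have "card {\<sigma> \<in> M. \<not> simple_word \<sigma> w} * (3 * n - 2 * m) \<le> 3 * m * m * card M"
      unfolding M_def using assms(1) that by (rule card_not_simple_word)
    then have "real (card {\<sigma> \<in> M. \<not> simple_word \<sigma> w} * (3 * n - 2 * m)) \<le> real (3 * m * m * card M)"
      by (rule of_nat_mono)
    then show ?thesis
      using assms(2) r by (simp add: of_nat_card_filter[OF fin] pos_le_divide_eq of_nat_diff power2_eq_square)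
  qed
  then have "(\<Sum>w\<in>?W. \<Sum>\<sigma>\<in>M. of_bool (\<not> simple_word \<sigma> w)) \<le> card ?W * (3 * (real m)\<^sup>2 * card M / ?r)"
    by (intro sum_bounded_above)
  then have "(\<Sum>\<sigma>\<in>M. \<Sum>w\<in>?W. of_bool (\<not> simple_word \<sigma> w)) \<le> card ?W * (3 * (real m)\<^sup>2 * card M / ?r)"
    by (subst sum.swap)
  then have first: "(\<Sum>\<sigma>\<in>M. (\<Sum>w\<in>?W. of_bool (\<not> simple_word \<sigma> w)) / card ?W) \<le> 3 * (real m)\<^sup>2 * card M / ?r"
    using card_nb_words_pos[of m]
    by (simp add: pos_divide_le_eq mult.commute flip: sum_divide_distrib)
  \<comment> \<open>Cauchy-Schwarz is applied once, to all pairs of a matching and a vertex of its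
    set, so only the average size of the sets enters.\<close>
  let ?S = "Sigma M B"
  have cardS: "real (card ?S) \<le> b * card M"
    using assms(5) fin finB by simp
  have "(\<Sum>(\<sigma>, v)\<in>?S. simple_frac m \<sigma> v)\<^sup>2 = (\<Sum>p\<in>?S. 1 * simple_frac m (fst p) (snd p))\<^sup>2"
    by (simp add: case_prod_unfold)
  also have "\<dots> \<le> (\<Sum>p\<in>?S. 1\<^sup>2) * (\<Sum>p\<in>?S. (simple_frac m (fst p) (snd p))\<^sup>2)"
    by (rule Cauchy_Schwarz_ineq_sum)
  also have "(\<Sum>p\<in>?S. (simple_frac m (fst p) (snd p))\<^sup>2) = (\<Sum>\<sigma>\<in>M. \<Sum>v\<in>B \<sigma>. (simple_frac m \<sigma> v)\<^sup>2)"
    using fin finB by (subst sum.Sigma) (auto simp: case_prod_unfold)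
  also have "(\<Sum>p\<in>?S. 1\<^sup>2) * \<dots> \<le> (b * card M) * (card M * ?\<beta>)"
  proof (rule mult_mono)
    have "(\<Sum>\<sigma>\<in>M. \<Sum>v\<in>B \<sigma>. (simple_frac m \<sigma> v)\<^sup>2) \<le> (\<Sum>\<sigma>\<in>M. \<Sum>v\<in>{1..n}. (simple_frac m \<sigma> v)\<^sup>2)"
      using B by (intro sum_mono sum_mono2) auto
    also have "\<dots> \<le> card M * ?\<beta>"
      unfolding M_def by (rule simple_frac_second_moment[OF assms(1,2)])
    finally show "(\<Sum>\<sigma>\<in>M. \<Sum>v\<in>B \<sigma>. (simple_frac m \<sigma> v)\<^sup>2) \<le> card M * ?\<beta>" .
    show "0 \<le> b * card M" using cardS by linarith
  qed (use cardS in \<open>auto intro!: sum_nonneg\<close>)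
  also have "\<dots> = (real (card M))\<^sup>2 * (b * ?\<beta>)" by (simp add: power2_eq_square)
  finally have "(\<Sum>(\<sigma>, v)\<in>?S. simple_frac m \<sigma> v) \<le> sqrt ((real (card M))\<^sup>2 * (b * ?\<beta>))"
    by (rule real_le_rsqrt)
  also have "\<dots> = card M * sqrt (b * ?\<beta>)" by (simp only: real_sqrt_mult real_sqrt_abs abs_of_nat)
  finally have second: "(\<Sum>\<sigma>\<in>M. \<Sum>v\<in>B \<sigma>. simple_frac m \<sigma> v) \<le> card M * sqrt (b * ?\<beta>)"
    using fin finB by (subst sum.Sigma) auto
  have "(\<Sum>\<sigma>\<in>M. nb_avg \<sigma> (indicator (B \<sigma>)) m)
      \<le> (\<Sum>\<sigma>\<in>M. (\<Sum>w\<in>?W. of_bool (\<not> simple_word \<sigma> w)) / card ?W + (\<Sum>v\<in>B \<sigma>. simple_frac m \<sigma> v))"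
    by (rule sum_mono) (rule split)
  also have "\<dots> \<le> 3 * (real m)\<^sup>2 * card M / ?r + card M * sqrt (b * ?\<beta>)"
    unfolding sum.distrib by (intro add_mono first second)
  finally show ?thesis by (simp add: algebra_simps)
qed

text \<open>Bounds the mean over the matchings of the sum of squares of
  \<open>simple_frac m \<sigma>\<close>, with the number of words replaced by its lower bound
  \<open>2 ^ m\<close>.\<close>

definition collision_bound :: "nat \<Rightarrow> nat \<Rightarrow> real" where
  "collision_bound n m = 2 powr - real m + 3 / (3 * real n - 4 * real m)"

definition self_hit_bound :: "nat \<Rightarrow> nat \<Rightarrow> real" where
  "self_hit_bound n m = 3 * (real m)\<^sup>2 / (3 * real n - 2 * real m)"

lemma collision_bound_pos:
  assumes "4 * m < 3 * n"
  shows "collision_bound n m > 0"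
proof -
  have "3 * real n - 4 * real m > 0" using assms by linarith
  then show ?thesis by (simp add: collision_bound_def add_pos_pos)
qed

lemma nb_avg_indicator_le:
  fixes B :: "(nat \<Rightarrow> nat) \<Rightarrow> nat set" and b :: real
  assumes "n \<ge> 1" "4 * m < 3 * n"
  defines "M \<equiv> perfect_matchings (mini_vertices n)"
  assumes B: "\<And>\<sigma>. \<sigma> \<in> M \<Longrightarrow> B \<sigma> \<subseteq> {1..n}" and b: "(\<Sum>\<sigma>\<in>M. real (card (B \<sigma>))) \<le> b * card M" "0 \<le> b"
  shows "(\<Sum>\<sigma>\<in>M. nb_avg \<sigma> (indicator (B \<sigma>)) m) \<le> card M *
    (self_hit_bound n m + sqrt (b * collision_bound n m))"
proof -
  have "(2::real) ^ m \<le> card (nb_words m)"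
    using card_nb_words_ge[of m] by (metis of_nat_le_iff of_nat_numeral of_nat_power)
  then have "1 / card (nb_words m) \<le> 1 / 2 ^ m"
    by (intro divide_left_mono) (simp_all add: card_nb_words_pos)
  also have "1 / 2 ^ m = 2 powr - real m" by (simp add: powr_minus_divide powr_realpow)
  finally have "1 / card (nb_words m) + 3 / (3 * real n - 4 * real m) \<le> collision_bound n m"
    by (simp add: collision_bound_def)
  then have "sqrt (b * (1 / card (nb_words m) + 3 / (3 * real n - 4 * real m))) \<le> sqrt (b * collision_bound n m)"
    using b(2) by (intro real_sqrt_le_mono mult_left_mono)
  then have "card M * (self_hit_bound n m + sqrt (b * (1 / card (nb_words m) + 3 / (3 * real n - 4 * real m))))
    \<le> card M * (self_hit_bound n m + sqrt (b * collision_bound n m))"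
    by (intro mult_left_mono) auto
  moreover note nb_avg_indicator_bound[OF assms(1,2) B[unfolded M_def] b(1)[unfolded M_def], folded M_def self_hit_bound_def]
  ultimately show ?thesis by linarith
qed

section \<open>Vertices reached and vertices missed by paths of given length\<close>

definition nb_ends :: "(nat \<Rightarrow> nat) \<Rightarrow> nat \<Rightarrow> nat set" where
  "nb_ends \<sigma> j = (\<lambda>w. arr \<sigma> w div 3) ` nb_words j"

lemma nb_ends_subset:
  assumes "\<sigma> \<in> perfect_matchings (mini_vertices n)" "n \<ge> 1"
  shows "nb_ends \<sigma> j \<subseteq> {1..n}"
  using arr_in[OF assms] by (auto simp: nb_ends_def mini_vertices_iff)

text \<open>There are at most \<open>3/2 * 2 ^ j\<close> words of length \<open>j\<close>, so the
  geometric sum stays below \<open>3/2 * 2 ^ J\<close>; rounding \<open>r\<close> up to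
  \<open>J\<close> costs at most a factor 2.\<close>

lemma card_nb_ends_Union_le: "real (card (\<Union>j\<in>{j. real j < r}. nb_ends \<sigma> j)) \<le> 3 * 2 powr r"
proof -
  define J where "J = nat \<lceil>r\<rceil>"
  have J: "{j. real j < r} = {..<J}"
    unfolding J_def by (auto simp: less_ceiling_iff zless_nat_conj nat_less_iff zless_nat_eq_int_zless)
  have "card (\<Union>j\<in>{..<J}. nb_ends \<sigma> j) \<le> (\<Sum>j<J. card (nb_ends \<sigma> j))"
    by (rule card_UN_le) simp
  also have "\<dots> \<le> (\<Sum>j<J. card (nb_words j))"
    unfolding nb_ends_def by (intro sum_mono card_image_le finite_nb_words)
  finally have "2 * card (\<Union>j\<in>{..<J}. nb_ends \<sigma> j) \<le> (\<Sum>j<J. 2 * card (nb_words j))"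
    by (simp add: sum_distrib_left[symmetric])
  also have "\<dots> \<le> (\<Sum>j<J. 3 * 2 ^ j)"
    by (intro sum_mono card_nb_words_le)
  also have "\<dots> = 3 * (2 ^ J - 1)"
    by (simp add: sum_distrib_left[symmetric] mask_eq_sum_exp_nat lessThan_def)
  finally have *: "2 * real (card (\<Union>j\<in>{..<J}. nb_ends \<sigma> j)) \<le> real (3 * (2 ^ J - 1))"
    by (metis of_nat_le_iff of_nat_mult of_nat_numeral)
  show ?thesis
  proof (cases "J = 0")
    case True
    then show ?thesis unfolding J by simp
  next
    case False
    then have "real J \<le> r + 1" unfolding J_def by linarith
    then have "2 powr real J \<le> 2 powr (r + 1)" by simp
    then have "(2::real) ^ J \<le> 2 * 2 powr r" by (simp add: powr_realpow powr_add)
    moreover have "real (3 * (2 ^ J - 1)) \<le> 3 * 2 ^ J" by (simp add: of_nat_diff)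
    ultimately show ?thesis using * unfolding J by linarith
  qed
qed

lemma nb_avg_near_le:
  assumes "n \<ge> 1" "4 * m < 3 * n"
  defines "M \<equiv> perfect_matchings (mini_vertices n)"
  shows "(\<Sum>\<sigma>\<in>M. nb_avg \<sigma> (indicator (\<Union>j\<in>{j. real j < r}. nb_ends \<sigma> j)) m) \<le> card M *
    (self_hit_bound n m + sqrt (3 * 2 powr r * collision_bound n m))"
  unfolding M_def
proof (rule nb_avg_indicator_le[OF assms(1,2)])
  show "(\<Union>j\<in>{j. real j < r}. nb_ends \<sigma> j) \<subseteq> {1..n}"
    if "\<sigma> \<in> perfect_matchings (mini_vertices n)" for \<sigma>
    using nb_ends_subset[OF that assms(1)] by blast
  show "(\<Sum>\<sigma>\<in>perfect_matchings (mini_vertices n). real (card (\<Union>j\<in>{j. real j < r}. nb_ends \<sigma> j)))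
    \<le> 3 * 2 powr r * card (perfect_matchings (mini_vertices n))"
    using sum_bounded_above[of "perfect_matchings (mini_vertices n)", OF card_nb_ends_Union_le]
    by (simp add: mult.commute)
qed simp

text \<open>The estimate for small sets is used twice. Paths of length \<open>l\<close> always end
  in \<open>nb_ends \<sigma> l\<close>, which forces this set to be large on average. Its complement
  is then small, and paths of length \<open>m\<close> rarely end there.\<close>

lemma nb_avg_missed_le:
  assumes "even n" "n \<ge> 1" "4 * m < 3 * n" "4 * l < 3 * n" "self_hit_bound n l \<le> 1"
  defines "M \<equiv> perfect_matchings (mini_vertices n)"
  shows "(\<Sum>\<sigma>\<in>M. nb_avg \<sigma> (indicator ({1..n} - nb_ends \<sigma> l)) m) \<le> card M *
    (self_hit_bound n m + sqrt ((n - (1 - self_hit_bound n l)\<^sup>2 / collision_bound n l) * collision_bound n m))"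
proof -
  have fin: "finite M" by (simp add: M_def finite_perfect_matchings)
  have pos: "card M > 0"
    using fin perfect_matchings_nonempty[OF assms(1)] by (simp add: M_def card_gt_0_iff)
  have sub: "nb_ends \<sigma> l \<subseteq> {1..n}" if "\<sigma> \<in> M" for \<sigma>
    using that assms(2) nb_ends_subset unfolding M_def by blast
  define s where "s = (\<Sum>\<sigma>\<in>M. real (card (nb_ends \<sigma> l))) / card M"
  have s: "(\<Sum>\<sigma>\<in>M. real (card (nb_ends \<sigma> l))) = s * card M" "0 \<le> s"
    unfolding s_def using pos by (auto intro!: sum_nonneg divide_nonneg_nonneg)
  have "(\<Sum>\<sigma>\<in>M. nb_avg \<sigma> (indicator (nb_ends \<sigma> l)) l) \<le> card M * (self_hit_bound n l + sqrt (s * collision_bound n l))"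
    unfolding M_def using sub s assms(2,4) unfolding M_def by (intro nb_avg_indicator_le) auto
  moreover have "nb_avg \<sigma> (indicator (nb_ends \<sigma> l)) l = 1" for \<sigma>
  proof -
    have "(\<Sum>w\<in>nb_words l. indicator (nb_ends \<sigma> l) (arr \<sigma> w div 3)) = (\<Sum>w\<in>nb_words l. 1::real)"
      by (intro sum.cong) (auto simp: nb_ends_def)
    then show ?thesis using card_nb_words_pos[of l] by (simp add: nb_avg_def)
  qed
  ultimately have "real (card M) * 1 \<le> card M * (self_hit_bound n l + sqrt (s * collision_bound n l))"
    by simp
  then have "1 \<le> self_hit_bound n l + sqrt (s * collision_bound n l)"
    using pos by (subst (asm) mult_le_cancel_left_pos) auto
  then have "(1 - self_hit_bound n l)\<^sup>2 \<le> (sqrt (s * collision_bound n l))\<^sup>2"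
    using assms(5) by (intro power_mono) auto
  also have "\<dots> = s * collision_bound n l"
    using s(2) collision_bound_pos[OF assms(4)] by simp
  finally have "(1 - self_hit_bound n l)\<^sup>2 / collision_bound n l \<le> s"
    using collision_bound_pos[OF assms(4)] by (simp add: pos_divide_le_eq)
  then have b: "n - s \<le> n - (1 - self_hit_bound n l)\<^sup>2 / collision_bound n l" by simp
  have "(\<Sum>\<sigma>\<in>M. real (card ({1..n} - nb_ends \<sigma> l))) = (\<Sum>\<sigma>\<in>M. real n - real (card (nb_ends \<sigma> l)))"
  proof (intro sum.cong refl)
    fix \<sigma> assume "\<sigma> \<in> M"
    from sub[OF this] show "real (card ({1..n} - nb_ends \<sigma> l)) = real n - real (card (nb_ends \<sigma> l))"
      using card_mono[OF _ sub[OF \<open>\<sigma> \<in> M\<close>]] by (simp add: card_Diff_subset finite_subset of_nat_diff)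
  qed
  also have "\<dots> = (n - s) * card M"
    by (simp add: sum_subtractf s(1) algebra_simps)
  finally have sum: "(\<Sum>\<sigma>\<in>M. real (card ({1..n} - nb_ends \<sigma> l))) = (n - s) * card M" .
  then have "0 \<le> (n - s) * card M" by (metis sum_nonneg of_nat_0_le_iff)
  then have "0 \<le> n - s" using pos by (simp add: zero_le_mult_iff)
  with b have "0 \<le> n - (1 - self_hit_bound n l)\<^sup>2 / collision_bound n l" by linarith
  moreover have "(\<Sum>\<sigma>\<in>M. real (card ({1..n} - nb_ends \<sigma> l))) \<le> (n - (1 - self_hit_bound n l)\<^sup>2 / collision_bound n l) * card M"
    unfolding sum using b by (intro mult_right_mono) auto
  ultimately show ?thesis
    unfolding M_def using assms(2,3) by (intro nb_avg_indicator_le) auto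
qed

section \<open>Law of the walk\<close>

abbreviation step_choices :: "(nat \<Rightarrow> nat) measure" where
  "step_choices \<equiv> \<Pi>\<^sub>M k\<in>UNIV. measure_pmf (pmf_of_set {0..<3})"

text \<open>The start is a parameter because the induction for the law of the walk removes the first
  step, while \<open>walk\<close> recurses on the last.\<close>

primrec walk_from :: "nat \<Rightarrow> (nat \<Rightarrow> nat) \<Rightarrow> (nat \<Rightarrow> nat) \<Rightarrow> nat \<Rightarrow> nat" where
  "walk_from v \<sigma> \<omega> 0 = v"
| "walk_from v \<sigma> \<omega> (Suc k) = \<sigma> (3 * walk_from v \<sigma> \<omega> k + \<omega> k) div 3"

lemma walk_eq_walk_from: "walk x k = walk_from 1 (fst x) (snd x) k"
  by (induction k) auto

lemma walk_from_case_nat: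
  "walk_from v \<sigma> (case_nat i \<omega>) (Suc k) = walk_from (\<sigma> (3 * v + i) div 3) \<sigma> \<omega> k"
  by (induction k) auto

lemma measurable_walk_from: "(\<lambda>\<omega>. walk_from v \<sigma> \<omega> k) \<in> step_choices \<rightarrow>\<^sub>M count_space UNIV"
proof (induction k)
  case (Suc k)
  have "(\<lambda>\<omega>. \<omega> k) \<in> step_choices \<rightarrow>\<^sub>M count_space UNIV" by measurable
  moreover have "(\<lambda>\<omega>. 3 * f \<omega> + g \<omega>) \<in> step_choices \<rightarrow>\<^sub>M count_space UNIV"
    if "f \<in> step_choices \<rightarrow>\<^sub>M count_space UNIV" "g \<in> step_choices \<rightarrow>\<^sub>M count_space UNIV"
    for f g :: "(nat \<Rightarrow> nat) \<Rightarrow> nat"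
    using that by measurable
  ultimately have "(\<lambda>\<omega>. 3 * walk_from v \<sigma> \<omega> k + \<omega> k) \<in> step_choices \<rightarrow>\<^sub>M count_space UNIV"
    using Suc by blast
  then show ?case
    unfolding walk_from.simps by (rule measurable_compose) simp
qed simp

lemma walk_step_nonneg: "(\<And>v. f v \<ge> 0) \<Longrightarrow> (walk_step \<sigma> ^^ k) f v \<ge> 0"
  by (induction k arbitrary: v) (auto simp: walk_step_def intro!: sum_nonneg)

lemma sigma_finite_step_choices: "sigma_finite_measure step_choices"
  by (intro prob_space_imp_sigma_finite prob_space_PiM prob_space_measure_pmf)

text \<open>Conditioning on the first choice: the sequence space is the law of
  \<open>case_nat i \<omega>\<close> with \<open>i\<close> and \<open>\<omega>\<close> independent,
  so the extra step applies \<open>walk_step\<close> once more.\<close>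

lemma emeasure_walk_from:
  "emeasure step_choices {\<omega> \<in> space step_choices. walk_from v \<sigma> \<omega> k \<in> B} =
     ennreal ((walk_step \<sigma> ^^ k) (indicator B) v)"
proof (induction k arbitrary: v)
  case 0
  interpret S: prob_space step_choices
    by (intro prob_space_PiM prob_space_measure_pmf)
  show ?case using S.emeasure_space_1 by (auto simp: indicator_def)
next
  case (Suc k)
  let ?p = "measure_pmf (pmf_of_set {0..<3::nat})"
  interpret sequence_space ?p
    by (simp add: sequence_space_def product_prob_space_def product_sigma_finite_def product_prob_space_axioms_def
        prob_space_measure_pmf prob_space_imp_sigma_finite)
  let ?f = "\<lambda>(s, \<omega>). case_nat s \<omega> :: nat \<Rightarrow> nat"
  let ?A = "{\<omega> \<in> space step_choices. walk_from v \<sigma> \<omega> (Suc k) \<in> B}"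
  have A: "?A \<in> sets step_choices"
    by (rule measurable_sets_Collect[OF measurable_walk_from]) simp
  have f: "?f \<in> ?p \<Otimes>\<^sub>M step_choices \<rightarrow>\<^sub>M step_choices"
    by measurable
  have sp: "space step_choices = UNIV" by (simp add: space_PiM)
  have "emeasure step_choices ?A = emeasure (distr (?p \<Otimes>\<^sub>M step_choices) step_choices ?f) ?A"
    by (simp only: PiM_iter)
  also have "\<dots> = emeasure (?p \<Otimes>\<^sub>M step_choices) (?f -` ?A \<inter> space (?p \<Otimes>\<^sub>M step_choices))"
    by (rule emeasure_distr[OF f A])
  also have "\<dots> = (\<integral>\<^sup>+i. emeasure step_choices (Pair i -` (?f -` ?A \<inter> space (?p \<Otimes>\<^sub>M step_choices))) \<partial>?p)"
    by (rule sigma_finite_measure.emeasure_pair_measure_alt[OF sigma_finite_step_choices]) (rule measurable_sets[OF f A])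
  also have "\<dots> = (\<integral>\<^sup>+i. ennreal ((walk_step \<sigma> ^^ k) (indicator B) (\<sigma> (3 * v + i) div 3)) \<partial>?p)"
  proof (rule nn_integral_cong)
    fix i
    have "Pair i -` (?f -` ?A \<inter> space (?p \<Otimes>\<^sub>M step_choices)) =
        {\<omega> \<in> space step_choices. walk_from (\<sigma> (3 * v + i) div 3) \<sigma> \<omega> k \<in> B}"
      by (auto simp: space_pair_measure sp walk_from_case_nat simp del: walk_from.simps)
    then show "emeasure step_choices (Pair i -` (?f -` ?A \<inter> space (?p \<Otimes>\<^sub>M step_choices))) =
        ennreal ((walk_step \<sigma> ^^ k) (indicator B) (\<sigma> (3 * v + i) div 3))"
      by (simp only: Suc.IH)
  qed
  also have "\<dots> = (\<Sum>i\<in>{0..<3}. ennreal ((walk_step \<sigma> ^^ k) (indicator B) (\<sigma> (3 * v + i) div 3))) / 3"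
    by (subst nn_integral_pmf_of_set) auto
  also have "\<dots> = ennreal ((\<Sum>i\<in>{0..<3}. (walk_step \<sigma> ^^ k) (indicator B) (\<sigma> (3 * v + i) div 3)) / 3)"
    by (simp add: sum_ennreal walk_step_nonneg sum_nonneg divide_ennreal[symmetric])
  also have "\<dots> = ennreal ((walk_step \<sigma> ^^ Suc k) (indicator B) v)"
    by (simp add: walk_step_def[of \<sigma> "(walk_step \<sigma> ^^ k) (indicator B)"] atLeast0LessThan)
  finally show ?case .
qed

text \<open>Fubini with the choices integrated out first, since the target set depends on the
  matching.\<close>

lemma measure_walk_in:
  fixes B :: "(nat \<Rightarrow> nat) \<Rightarrow> nat set"
  assumes "even n"
  defines "M \<equiv> perfect_matchings (mini_vertices n)"
  shows "measure (graph_walk_space n) {x \<in> space (graph_walk_space n). walk x k \<in> B (fst x)} =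
    (\<Sum>\<sigma>\<in>M. (walk_step \<sigma> ^^ k) (indicator (B \<sigma>)) 1) / card M"
proof -
  let ?p = "measure_pmf (pmf_of_set M)"
  have M: "finite M" "M \<noteq> {}"
    using perfect_matchings_nonempty[OF assms(1)] by (auto simp: M_def finite_perfect_matchings)
  have g: "graph_walk_space n = ?p \<Otimes>\<^sub>M step_choices"
    by (simp add: graph_walk_space_def M_def)
  let ?A = "{x \<in> space (graph_walk_space n). walk x k \<in> B (fst x)}"
  have "(\<lambda>x. walk x k \<in> B (fst x)) \<in> graph_walk_space n \<rightarrow>\<^sub>M count_space UNIV"
    by (rule measurable_apply_matching[OF measurable_walk]) simp
  then have A: "?A \<in> sets (graph_walk_space n)"
    by (rule predE)
  have nonneg: "0 \<le> (walk_step \<sigma> ^^ k) (indicator C) v" for \<sigma> C v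
    by (rule walk_step_nonneg) simp
  have "emeasure (graph_walk_space n) ?A = (\<integral>\<^sup>+\<sigma>. emeasure step_choices (Pair \<sigma> -` ?A) \<partial>?p)"
    using A unfolding g by (rule sigma_finite_measure.emeasure_pair_measure_alt[OF sigma_finite_step_choices])
  also have "\<dots> = (\<integral>\<^sup>+\<sigma>. ennreal ((walk_step \<sigma> ^^ k) (indicator (B \<sigma>)) 1) \<partial>?p)"
  proof (rule nn_integral_cong)
    fix \<sigma>
    have "Pair \<sigma> -` ?A = {\<omega> \<in> space step_choices. walk_from 1 \<sigma> \<omega> k \<in> B \<sigma>}"
      by (auto simp: g space_pair_measure walk_eq_walk_from)
    then show "emeasure step_choices (Pair \<sigma> -` ?A) = ennreal ((walk_step \<sigma> ^^ k) (indicator (B \<sigma>)) 1)"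
      by (simp only: emeasure_walk_from)
  qed
  also have "\<dots> = (\<Sum>\<sigma>\<in>M. ennreal ((walk_step \<sigma> ^^ k) (indicator (B \<sigma>)) 1)) / card M"
    by (rule nn_integral_pmf_of_set[OF M(2,1)])
  also have "\<dots> = ennreal ((\<Sum>\<sigma>\<in>M. (walk_step \<sigma> ^^ k) (indicator (B \<sigma>)) 1) / card M)"
    using M by (simp add: sum_ennreal nonneg sum_nonneg divide_ennreal[symmetric] ennreal_of_nat_eq_real_of_nat card_gt_0_iff)
  finally show ?thesis
    by (simp add: measure_def nonneg sum_nonneg)
qed

section \<open>Asymptotics\<close>

text \<open>A distance that is too small exhibits a short word ending at \<open>v\<close>. One that
  is too large, possibly infinite, rules out every word of length at most
  \<open>(c + \<epsilon>) * L\<close> ending there.\<close>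

lemma graph_dist_deviation:
  assumes "\<sigma> \<in> perfect_matchings (mini_vertices n)" "n \<ge> 1" "L > 0"
    and dev: "\<bar>graph_dist (cubic_graph n \<sigma>) v 1 / ereal L - ereal c\<bar> > ereal \<epsilon>"
  shows "v \<in> (\<Union>j\<in>{j. real j < (c - \<epsilon>) * L}. nb_ends \<sigma> j) \<or>
    (\<forall>j. v \<in> nb_ends \<sigma> j \<longrightarrow> (c + \<epsilon>) * L < real j)"
proof (rule ccontr)
  assume "\<not> ?thesis"
  then obtain j where near: "v \<notin> (\<Union>j\<in>{j. real j < (c - \<epsilon>) * L}. nb_ends \<sigma> j)"
    and j: "v \<in> nb_ends \<sigma> j" "real j \<le> (c + \<epsilon>) * L"
    by (auto simp: not_less)
  let ?d = "graph_dist (cubic_graph n \<sigma>) v 1"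
  have "\<not> ?d < ereal ((c - \<epsilon>) * L)"
    using nb_word_of_graph_dist[OF assms(1), of v] near by (force simp: nb_ends_def)
  then have lower: "ereal ((c - \<epsilon>) * L) \<le> ?d" by simp
  obtain w where w: "w \<in> nb_words j" "v = arr \<sigma> w div 3"
    using j(1) by (auto simp: nb_ends_def)
  have "?d \<le> ereal (length w)"
    unfolding w(2) by (rule graph_dist_arr_le[OF assms(1,2)])
  also have "\<dots> \<le> ereal ((c + \<epsilon>) * L)"
    using j(2) length_nb_words[OF w(1)] by simp
  finally have upper: "?d \<le> ereal ((c + \<epsilon>) * L)" .
  obtain r where r: "?d = ereal r"
    using lower upper by (cases ?d) auto
  then have "(c - \<epsilon>) * L \<le> r" "r \<le> (c + \<epsilon>) * L" using lower upper by auto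
  then have "c - \<epsilon> \<le> r / L" "r / L \<le> c + \<epsilon>"
    using assms(3) by (simp_all add: pos_le_divide_eq pos_divide_le_eq)
  then have "\<bar>r / L - c\<bar> \<le> \<epsilon>" by linarith
  then show False using dev assms(3) unfolding r by simp
qed

section \<open>Error terms uniform in the path length\<close>

lemma self_hit_bound_mono:
  assumes "real m \<le> x" "4 * x < 3 * real n"
  shows "self_hit_bound n m \<le> 3 * x\<^sup>2 / (3 * real n - 2 * x)"
  unfolding self_hit_bound_def using assms by (intro frac_le mult_left_mono power_mono) auto

lemma nb_avg_mono:
  assumes "\<And>w. w \<in> nb_words m \<Longrightarrow> f (arr \<sigma> w div 3) \<le> g (arr \<sigma> w div 3)"
  shows "nb_avg \<sigma> f m \<le> nb_avg \<sigma> g m"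
  unfolding nb_avg_def using assms by (intro divide_right_mono sum_mono) auto

lemma nb_avg_add: "nb_avg \<sigma> (\<lambda>v. f v + g v) m = nb_avg \<sigma> f m + nb_avg \<sigma> g m"
  by (simp add: nb_avg_def sum.distrib add_divide_distrib)

lemma nb_avg_indicator_le_1: "nb_avg \<sigma> (indicator B) m \<le> 1"
proof -
  have "(\<Sum>w\<in>nb_words m. indicator B (arr \<sigma> w div 3)) \<le> real (card (nb_words m)) * 1"
    by (intro sum_bounded_above) (simp add: indicator_def)
  then show ?thesis using card_nb_words_pos[of m] by (simp add: nb_avg_def)
qed

lemma two_powr_log: "n \<ge> 1 \<Longrightarrow> 2 powr (a * log 2 (real n)) = real n powr a"
  by (simp add: powr_def log_def)

text \<open>The exponent \<open>r\<close> lies \<open>\<delta> * log 2 n\<close> below the path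
  length and \<open>\<epsilon> * log 2 n\<close> below \<open>log 2 n\<close>; these gaps control
  the two summands of \<open>collision_bound\<close>. The length enters the result only through its
  upper bound \<open>hi\<close>.\<close>

lemma near_term_le:
  assumes "n \<ge> 1" "real m \<le> hi" "4 * hi < 3 * real n"
    and "r - real m \<le> - \<delta> * log 2 (real n)" "r \<le> (1 - \<epsilon>) * log 2 (real n)"
  shows "2 powr r * collision_bound n m \<le>
    real n powr - \<delta> + real n powr - \<epsilon> * (real n * (3 / (3 * real n - 4 * hi)))"
proof -
  have "2 powr r * 2 powr - real m = 2 powr (r - real m)" by (simp add: powr_diff powr_minus_divide)
  also have "\<dots> \<le> 2 powr (- \<delta> * log 2 (real n))" using assms(4) by simp
  also have "\<dots> = real n powr - \<delta>" by (rule two_powr_log) fact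
  finally have 1: "2 powr r * 2 powr - real m \<le> real n powr - \<delta>" .
  have "2 powr r \<le> 2 powr ((1 - \<epsilon>) * log 2 (real n))" using assms(5) by simp
  also have "\<dots> = real n powr (1 - \<epsilon>)" by (rule two_powr_log) fact
  also have "\<dots> = real n powr - \<epsilon> * real n"
    using assms(1) powr_add[of "real n" "- \<epsilon>" 1] by simp
  finally have "2 powr r * (3 / (3 * real n - 4 * real m)) \<le> real n powr - \<epsilon> * real n * (3 / (3 * real n - 4 * hi))"
    using assms(2,3) by (intro mult_mono frac_le) auto
  with 1 show ?thesis unfolding collision_bound_def distrib_left mult.assoc by linarith
qed

text \<open>Multiplied by \<open>n\<close>, both collision bounds are dominated by quantities that
  tend to 1. The fraction of missed vertices is then at most 1 minus a quotient that tends to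
  1.\<close>

lemma far_term_le:
  assumes "even n" "n \<ge> 1" "l = nat \<lfloor>h\<rfloor>" "h = (1 + \<epsilon>) * log 2 (real n)" "0 \<le> h" "4 * h < 3 * real n"
    and "3 * h\<^sup>2 / (3 * real n - 2 * h) \<le> 1"
    and "h < real m" "real m \<le> hi" "4 * hi < 3 * real n"
  shows "(n - (1 - self_hit_bound n l)\<^sup>2 / collision_bound n l) * collision_bound n m \<le>
    \<bar>1 - (1 - 3 * h\<^sup>2 / (3 * real n - 2 * h))\<^sup>2 / (2 * real n powr - \<epsilon> + real n * (3 / (3 * real n - 4 * h)))\<bar> *
      (real n powr - \<epsilon> + real n * (3 / (3 * real n - 4 * hi)))"
proof -
  have l: "real l \<le> h" "h \<le> real l + 1" using assms(3,5) by linarith+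
  have l4: "4 * l < 3 * n" using l assms(6) by linarith
  have nn: "2 powr - h = real n powr - \<epsilon> / real n"
  proof -
    have "- h = (- \<epsilon> - 1) * log 2 (real n)" by (simp add: assms(4) algebra_simps)
    then have "2 powr - h = 2 powr ((- \<epsilon> - 1) * log 2 (real n))" by (rule arg_cong)
    also have "\<dots> = real n powr (- \<epsilon> - 1)" by (rule two_powr_log) fact
    finally show ?thesis using assms(2) by (simp add: powr_diff)
  qed
  \<comment> \<open>Rounding \<open>h\<close> down to \<open>l\<close> costs the factor 2.\<close>
  have "2 powr - real l \<le> 2 powr (- h + 1)" using l by simp
  also have "\<dots> = 2 * (real n powr - \<epsilon> / real n)" unfolding powr_add nn by simp
  finally have "collision_bound n l \<le> 2 * (real n powr - \<epsilon> / real n) + 3 / (3 * real n - 4 * h)"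
    unfolding collision_bound_def using l assms(6) by (intro add_mono frac_le) auto
  also have "\<dots> = (2 * real n powr - \<epsilon> + real n * (3 / (3 * real n - 4 * h))) / real n"
    using assms(2) by (simp add: add_divide_distrib)
  finally have cl: "real n * collision_bound n l \<le> 2 * real n powr - \<epsilon> + real n * (3 / (3 * real n - 4 * h))"
    using assms(2) by (simp add: pos_le_divide_eq mult.commute)
  have "2 powr - real m \<le> 2 powr - h" using assms(8) by simp
  then have "collision_bound n m \<le> real n powr - \<epsilon> / real n + 3 / (3 * real n - 4 * hi)"
    unfolding collision_bound_def nn using assms(9,10) by (intro add_mono frac_le) auto
  also have "\<dots> = (real n powr - \<epsilon> + real n * (3 / (3 * real n - 4 * hi))) / real n"
    using assms(2) by (simp add: add_divide_distrib)
  finally have cm: "real n * collision_bound n m \<le> real n powr - \<epsilon> + real n * (3 / (3 * real n - 4 * hi))"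
    using assms(2) by (simp add: pos_le_divide_eq mult.commute)
  let ?A = "1 - 3 * h\<^sup>2 / (3 * real n - 2 * h)"
  let ?u = "2 * real n powr - \<epsilon> + real n * (3 / (3 * real n - 4 * h))"
  have pos: "0 < real n * collision_bound n l" "0 < real n * collision_bound n m"
    using assms(2) collision_bound_pos[OF l4] collision_bound_pos[of m n] assms(9,10) by simp_all
  have "?A\<^sup>2 / ?u \<le> (1 - self_hit_bound n l)\<^sup>2 / (real n * collision_bound n l)"
    using self_hit_bound_mono[OF l(1) assms(6)] assms(7) pos(1) cl
    by (intro frac_le power_mono) auto
  \<comment> \<open>The absolute value supplies the non-negative factor that multiplying the two
    estimates requires.\<close>
  then have "1 - (1 - self_hit_bound n l)\<^sup>2 / (real n * collision_bound n l) \<le> \<bar>1 - ?A\<^sup>2 / ?u\<bar>"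
    by linarith
  then have "(1 - (1 - self_hit_bound n l)\<^sup>2 / (real n * collision_bound n l)) * (real n * collision_bound n m)
    \<le> \<bar>1 - ?A\<^sup>2 / ?u\<bar> * (real n powr - \<epsilon> + real n * (3 / (3 * real n - 4 * hi)))"
    using cm pos(2) by (intro mult_mono) auto
  moreover have "(n - (1 - self_hit_bound n l)\<^sup>2 / collision_bound n l) * collision_bound n m =
      (1 - (1 - self_hit_bound n l)\<^sup>2 / (real n * collision_bound n l)) * (real n * collision_bound n m)"
    using assms(2) pos(1) by (simp add: field_simps)
  ultimately show ?thesis by linarith
qed

text \<open>\<open>hi\<close> is the largest path length considered, \<open>h\<close> the length at
  which almost all vertices are reached. The summands account for self-intersections, once for each
  use of the small-set estimate, for the ball about the start and for the missed vertices.\<close>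

definition deviation_bound :: "real \<Rightarrow> real \<Rightarrow> nat \<Rightarrow> real" where
  "deviation_bound T \<epsilon> n = (let L = log 2 (real n); hi = (T + \<epsilon> / 2) * L; h = (1 + \<epsilon>) * L in
     2 * (3 * hi\<^sup>2 / (3 * real n - 2 * hi)) +
     sqrt (3 * (real n powr - (\<epsilon> / 2) + real n powr - \<epsilon> * (real n * (3 / (3 * real n - 4 * hi))))) +
     sqrt (\<bar>1 - (1 - 3 * h\<^sup>2 / (3 * real n - 2 * h))\<^sup>2 / (2 * real n powr - \<epsilon> + real n * (3 / (3 * real n - 4 * h)))\<bar> *
       (real n powr - \<epsilon> + real n * (3 / (3 * real n - 4 * hi)))))"

lemma hit_tendsto_0:
  fixes a :: real
  assumes "a > 0"
  shows "(\<lambda>n. 3 * (a * log 2 (real n))\<^sup>2 / (3 * real n - 2 * (a * log 2 (real n)))) \<longlonglongrightarrow> 0"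
  using assms by real_asymp

lemma eventually_log_less_linear:
  fixes a :: real
  shows "\<forall>\<^sub>F n::nat in sequentially. 4 * (a * log 2 (real n)) < 3 * real n"
  by real_asymp

lemma deviation_bound_tendsto:
  assumes "\<epsilon> > 0" "T > 0"
  shows "deviation_bound T \<epsilon> \<longlonglongrightarrow> 0"
proof -
  have collide: "(\<lambda>n. real n * (3 / (3 * real n - 4 * (a * log 2 (real n))))) \<longlonglongrightarrow> 1" for a :: real
    by real_asymp
  have neg: "(\<lambda>n. real n powr - a) \<longlonglongrightarrow> 0" if "a > 0" for a :: real
    using that by real_asymp
  \<comment> \<open>The last root vanishes because its first factor tends to
    \<open>1 - 1 / 1\<close>: at length \<open>h\<close> the rescaled second moment bound has limit
    exactly 1.\<close>
  have "deviation_bound T \<epsilon> \<longlonglongrightarrow>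
    2 * 0 + sqrt (3 * (0 + 0 * 1)) + sqrt (\<bar>1 - (1 - 0)\<^sup>2 / (2 * 0 + 1)\<bar> * (0 + 1))"
    unfolding deviation_bound_def Let_def
    using assms by (intro tendsto_intros hit_tendsto_0 collide neg) auto
  then show ?thesis by simp
qed

text \<open>A path of length at most \<open>(c + \<epsilon>) * log 2 n\<close> itself bounds the
  distance from above, so only the ball remains. A longer one forces \<open>T > 1\<close> and
  \<open>c = 1\<close>; the distance can then be too large only at a vertex missed by all paths of
  length \<open>l\<close>.\<close>

lemma nb_avg_deviation_le:
  fixes T \<epsilon> :: real
  defines "c \<equiv> min T 1"
  assumes n: "even n" "n \<ge> 2" and "T > 0" "\<epsilon> > 0"
    and hi: "hi = (T + \<epsilon> / 2) * log 2 (real n)" "4 * hi < 3 * real n"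
    and h: "h = (1 + \<epsilon>) * log 2 (real n)" "4 * h < 3 * real n" "3 * h\<^sup>2 / (3 * real n - 2 * h) \<le> 1"
    and m: "\<bar>real m - T * log 2 (real n)\<bar> \<le> \<epsilon> / 2 * log 2 (real n)"
  defines "M \<equiv> perfect_matchings (mini_vertices n)"
  shows "(\<Sum>\<sigma>\<in>M. nb_avg \<sigma> (indicator
      {v. \<bar>graph_dist (cubic_graph n \<sigma>) v 1 / ereal (log 2 (real n)) - ereal c\<bar> > ereal \<epsilon>}) m)
    \<le> card M * \<bar>deviation_bound T \<epsilon> n\<bar>"
proof -
  define L where "L = log 2 (real n)"
  define Bad where "Bad \<sigma> = {v. \<bar>graph_dist (cubic_graph n \<sigma>) v 1 / ereal L - ereal c\<bar> > ereal \<epsilon>}" for \<sigma>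
  define near where "near \<sigma> = (\<Union>j\<in>{j. real j < (c - \<epsilon>) * L}. nb_ends \<sigma> j)" for \<sigma>
  let ?hit = "3 * hi\<^sup>2 / (3 * real n - 2 * hi)"
  let ?q1 = "real n powr - (\<epsilon> / 2) + real n powr - \<epsilon> * (real n * (3 / (3 * real n - 4 * hi)))"
  let ?q2 = "\<bar>1 - (1 - 3 * h\<^sup>2 / (3 * real n - 2 * h))\<^sup>2 / (2 * real n powr - \<epsilon> + real n * (3 / (3 * real n - 4 * h)))\<bar> *
       (real n powr - \<epsilon> + real n * (3 / (3 * real n - 4 * hi)))"
  have dev: "deviation_bound T \<epsilon> n = 2 * ?hit + sqrt (3 * ?q1) + sqrt ?q2"
    by (simp only: deviation_bound_def Let_def hi(1) h(1))
  have n1: "n \<ge> 1" using n(2) by simp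
  have "log 2 (real n) \<ge> log 2 2" using n(2) by (subst log_le_cancel_iff) auto
  then have L: "L \<ge> 1" by (simp add: L_def)
  have mhi: "real m \<le> hi" and mlo: "T * L - \<epsilon> / 2 * L \<le> real m"
    using abs_le_D1[OF m] abs_le_D2[OF m] unfolding hi(1) L_def by (simp_all add: algebra_simps)
  have m4: "4 * m < 3 * n" using mhi hi(2) by linarith
  have hit0: "0 \<le> ?hit" using hi(2) mhi by (intro divide_nonneg_nonneg) auto
  have q0: "0 \<le> ?q1" "0 \<le> ?q2"
    using hi(2) by (auto intro!: add_nonneg_nonneg mult_nonneg_nonneg)
  have hitm: "self_hit_bound n m \<le> ?hit" by (rule self_hit_bound_mono[OF mhi hi(2)])
  have M: "Bad \<sigma> \<inter> nb_ends \<sigma> m \<subseteq> near \<sigma> \<union> {v. \<forall>j. v \<in> nb_ends \<sigma> j \<longrightarrow> (c + \<epsilon>) * L < real j}"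
    if "\<sigma> \<in> M" for \<sigma>
    using graph_dist_deviation[OF that[unfolded M_def] n1, of L] L unfolding Bad_def near_def by auto
  have "(\<Sum>\<sigma>\<in>M. nb_avg \<sigma> (indicator (near \<sigma>)) m) \<le>
      card M * (self_hit_bound n m + sqrt (3 * 2 powr ((c - \<epsilon>) * L) * collision_bound n m))"
    unfolding M_def near_def by (rule nb_avg_near_le[OF n1 m4])
  also have "\<dots> \<le> card M * (?hit + sqrt (3 * ?q1))"
  proof (intro mult_left_mono add_mono real_sqrt_le_mono hitm)
    \<comment> \<open>The path length is at least \<open>(T - \<epsilon> / 2) * L\<close> and the
      radius at most \<open>(T - \<epsilon>) * L\<close>, which leaves the gap
      \<open>\<delta> = \<epsilon> / 2\<close>.\<close>
    have "(c - \<epsilon>) * L \<le> (T - \<epsilon>) * L" "(c - \<epsilon>) * L \<le> (1 - \<epsilon>) * L"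
      using L by (auto intro!: mult_right_mono simp: c_def)
    then have "2 powr ((c - \<epsilon>) * L) * collision_bound n m \<le> ?q1"
      using mlo unfolding L_def
      by (intro near_term_le[OF n1 mhi hi(2)]) (simp_all add: algebra_simps)
    then show "3 * 2 powr ((c - \<epsilon>) * L) * collision_bound n m \<le> 3 * ?q1" by simp
  qed simp
  finally have near: "(\<Sum>\<sigma>\<in>M. nb_avg \<sigma> (indicator (near \<sigma>)) m) \<le> card M * (?hit + sqrt (3 * ?q1))" .
  have "(\<Sum>\<sigma>\<in>M. nb_avg \<sigma> (indicator (Bad \<sigma>)) m) \<le> card M * (2 * ?hit + sqrt (3 * ?q1) + sqrt ?q2)"
  proof (cases "real m \<le> (c + \<epsilon>) * L")
    case True
    have "nb_avg \<sigma> (indicator (Bad \<sigma>)) m \<le> nb_avg \<sigma> (indicator (near \<sigma>)) m" if "\<sigma> \<in> M" for \<sigma>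
    proof (rule nb_avg_mono)
      fix w assume "w \<in> nb_words m"
      then have "arr \<sigma> w div 3 \<in> nb_ends \<sigma> m" by (auto simp: nb_ends_def)
      moreover from this True have "\<not> (\<forall>j. arr \<sigma> w div 3 \<in> nb_ends \<sigma> j \<longrightarrow> (c + \<epsilon>) * L < real j)"
        by (auto simp: not_less)
      ultimately have "arr \<sigma> w div 3 \<in> Bad \<sigma> \<Longrightarrow> arr \<sigma> w div 3 \<in> near \<sigma>"
        using M[OF that] by blast
      then show "indicator (Bad \<sigma>) (arr \<sigma> w div 3) \<le> (indicator (near \<sigma>) (arr \<sigma> w div 3) :: real)"
        unfolding indicator_def by simp
    qed
    then have "(\<Sum>\<sigma>\<in>M. nb_avg \<sigma> (indicator (Bad \<sigma>)) m) \<le> (\<Sum>\<sigma>\<in>M. nb_avg \<sigma> (indicator (near \<sigma>)) m)"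
      by (rule sum_mono)
    also have "\<dots> \<le> card M * (?hit + sqrt (3 * ?q1))" by (rule near)
    also have "\<dots> \<le> card M * (2 * ?hit + sqrt (3 * ?q1) + sqrt ?q2)"
    proof (rule mult_left_mono)
      have "0 \<le> sqrt ?q2" using q0(2) by (rule real_sqrt_ge_zero)
      with hit0 show "?hit + sqrt (3 * ?q1) \<le> 2 * ?hit + sqrt (3 * ?q1) + sqrt ?q2" by linarith
    qed simp
    finally show ?thesis .
  next
    case False
    \<comment> \<open>For \<open>c = T\<close> the upper bound
      \<open>m \<le> (T + \<epsilon> / 2) * L\<close> would contradict this case.\<close>
    have "\<epsilon> / 2 * L \<le> \<epsilon> * L" using L assms(5) by simp
    with False have "c * L < T * L"
      using mhi unfolding hi(1) L_def[symmetric] by (simp add: algebra_simps)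
    then have "c < T" using L by simp
    then have c1: "c = 1" by (simp add: c_def min_def split: if_splits)
    define l where "l = nat \<lfloor>h\<rfloor>"
    have h0: "0 \<le> h" using L assms(5) unfolding h(1) L_def by simp
    then have lh: "real l \<le> h" unfolding l_def by linarith
    have hm: "h < real m" using False unfolding c1 h(1) L_def by simp
    have "nb_avg \<sigma> (indicator (Bad \<sigma>)) m \<le>
        nb_avg \<sigma> (indicator (near \<sigma>)) m + nb_avg \<sigma> (indicator ({1..n} - nb_ends \<sigma> l)) m" if "\<sigma> \<in> M" for \<sigma>
      unfolding nb_avg_add[symmetric]
    proof (rule nb_avg_mono)
      fix w assume "w \<in> nb_words m"
      then have e: "arr \<sigma> w div 3 \<in> nb_ends \<sigma> m" by (auto simp: nb_ends_def)
      moreover have "arr \<sigma> w div 3 \<in> {1..n}"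
        using e nb_ends_subset[OF that[unfolded M_def] n1] by blast
      moreover have "\<not> (c + \<epsilon>) * L < real l" using lh unfolding c1 h(1) L_def by simp
      ultimately have "arr \<sigma> w div 3 \<in> Bad \<sigma> \<Longrightarrow>
          arr \<sigma> w div 3 \<in> near \<sigma> \<or> arr \<sigma> w div 3 \<in> {1..n} - nb_ends \<sigma> l"
        using M[OF that] by blast
      then show "indicator (Bad \<sigma>) (arr \<sigma> w div 3) \<le>
          indicator (near \<sigma>) (arr \<sigma> w div 3) + (indicator ({1..n} - nb_ends \<sigma> l) (arr \<sigma> w div 3) :: real)"
        unfolding indicator_def by auto
    qed
    then have "(\<Sum>\<sigma>\<in>M. nb_avg \<sigma> (indicator (Bad \<sigma>)) m) \<le>
        (\<Sum>\<sigma>\<in>M. nb_avg \<sigma> (indicator (near \<sigma>)) m) + (\<Sum>\<sigma>\<in>M. nb_avg \<sigma> (indicator ({1..n} - nb_ends \<sigma> l)) m)"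
      unfolding sum.distrib[symmetric] by (rule sum_mono)
    moreover have "(\<Sum>\<sigma>\<in>M. nb_avg \<sigma> (indicator ({1..n} - nb_ends \<sigma> l)) m) \<le> card M *
        (self_hit_bound n m + sqrt ((n - (1 - self_hit_bound n l)\<^sup>2 / collision_bound n l) * collision_bound n m))"
      unfolding M_def
      using lh h(2) self_hit_bound_mono[OF lh h(2)] h(3)
      by (intro nb_avg_missed_le n(1) n1 m4) linarith+
    moreover have "\<dots> \<le> card M * (?hit + sqrt ?q2)"
      by (intro mult_left_mono add_mono real_sqrt_le_mono hitm
          far_term_le[OF n(1) n1 l_def h(1) h0 h(2,3) hm mhi hi(2)]) simp
    moreover have "x * (2 * a + b + c) = x * (a + b) + x * (a + c)" for x a b c :: real
      by (simp add: algebra_simps)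
    ultimately show ?thesis using near by (simp only:)
  qed
  also have "\<dots> \<le> card M * \<bar>deviation_bound T \<epsilon> n\<bar>"
    unfolding dev by (intro mult_left_mono) auto
  finally show ?thesis by (simp add: Bad_def L_def)
qed

lemma walk_deviation_le:
  fixes t \<epsilon> :: real
  assumes n: "even n" "n \<ge> 2" and "t > 0" "\<epsilon> > 0"
    and hi: "4 * ((t / 3 + \<epsilon> / 2) * log 2 (real n)) < 3 * real n"
    and h: "h = (1 + \<epsilon>) * log 2 (real n)" "4 * h < 3 * real n" "3 * h\<^sup>2 / (3 * real n - 2 * h) \<le> 1"
    and large: "1 \<le> \<epsilon> / 4 * log 2 (real n)"
  shows "measure (graph_walk_space n) {x \<in> space (graph_walk_space n).
      \<bar>walk_dist n (nat \<lfloor>t * log 2 (real n)\<rfloor>) x / ereal (log 2 (real n)) - ereal (min (t / 3) 1)\<bar> > ereal \<epsilon>}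
    \<le> \<bar>deviation_bound (t / 3) \<epsilon> n\<bar> + 16 * t / \<epsilon>\<^sup>2 / log 2 (real n)"
proof -
  define L where "L = log 2 (real n)"
  define k where "k = nat \<lfloor>t * L\<rfloor>"
  define M where "M = perfect_matchings (mini_vertices n)"
  define Bad where "Bad \<sigma> = {v. \<bar>graph_dist (cubic_graph n \<sigma>) v 1 / ereal L - ereal (min (t / 3) 1)\<bar> > ereal \<epsilon>}" for \<sigma>
  have "finite M" "M \<noteq> {}"
    using perfect_matchings_nonempty[OF n(1)] by (simp_all add: M_def finite_perfect_matchings)
  then have pos: "real (card M) > 0" by (simp add: card_gt_0_iff)
  have L0: "L > 0" using n(2) by (simp add: L_def)
  then have k: "real k \<le> t * L" "t * L \<le> real k + 1" using assms(3) by (simp_all add: k_def)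
  \<comment> \<open>The length chain is the same for every matching, so the average over matchings
    moves inside \<open>radial_exp\<close> and leaves a function of the length alone.\<close>
  define G where "G m = (\<Sum>\<sigma>\<in>M. nb_avg \<sigma> (indicator (Bad \<sigma>)) m) / card M" for m
  have "measure (graph_walk_space n) {x \<in> space (graph_walk_space n). walk x k \<in> Bad (fst x)} =
      (\<Sum>\<sigma>\<in>M. (walk_step \<sigma> ^^ k) (indicator (Bad \<sigma>)) 1) / card M"
    unfolding M_def by (rule measure_walk_in[OF n(1)])
  also have "\<dots> = (\<Sum>\<sigma>\<in>M. radial_exp k (nb_avg \<sigma> (indicator (Bad \<sigma>)))) / card M"
    unfolding M_def by (intro arg_cong2[where f = "(/)"] sum.cong refl walk_step_funpow)
  also have "\<dots> = radial_exp k G"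
    using radial_exp_affine[of k "1 / card M" "\<lambda>m. \<Sum>\<sigma>\<in>M. nb_avg \<sigma> (indicator (Bad \<sigma>)) m" 0]
    by (simp add: G_def[abs_def] radial_exp_sum)
  also have "\<dots> \<le> \<bar>deviation_bound (t / 3) \<epsilon> n\<bar> + k / (\<epsilon> / 4 * L)\<^sup>2"
  proof (rule radial_exp_concentration)
    show "\<epsilon> / 4 * L > 0" using L0 assms(4) by simp
    fix m
    have "(\<Sum>\<sigma>\<in>M. nb_avg \<sigma> (indicator (Bad \<sigma>)) m) \<le> real (card M) * 1"
      by (intro sum_bounded_above nb_avg_indicator_le_1)
    then show "G m \<le> 1" using pos by (simp add: G_def)
    assume "\<bar>real m - real k / 3\<bar> \<le> \<epsilon> / 4 * L"
    \<comment> \<open>Replacing \<open>k / 3\<close> by \<open>t / 3 * L\<close> costs at most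
      \<open>1/3\<close>, which \<open>large\<close> absorbs in a second
      \<open>\<epsilon> / 4 * L\<close>.\<close>
    then have "\<bar>real m - t / 3 * L\<bar> \<le> \<epsilon> / 2 * L"
      using k large unfolding L_def[symmetric] by linarith
    then have "(\<Sum>\<sigma>\<in>M. nb_avg \<sigma> (indicator (Bad \<sigma>)) m) \<le> card M * \<bar>deviation_bound (t / 3) \<epsilon> n\<bar>"
      unfolding M_def Bad_def L_def using assms
      by (intro nb_avg_deviation_le[OF n _ _ refl hi h]) auto
    then show "G m \<le> \<bar>deviation_bound (t / 3) \<epsilon> n\<bar>"
      using pos by (simp add: G_def pos_divide_le_eq mult.commute)
  qed simp
  also have "k / (\<epsilon> / 4 * L)\<^sup>2 \<le> t * L / (\<epsilon> / 4 * L)\<^sup>2"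
    using k(1) by (rule divide_right_mono) simp
  also have "\<dots> = 16 * t / \<epsilon>\<^sup>2 / L"
    using L0 assms(4) by (simp add: field_simps power2_eq_square)
  finally show ?thesis
    by (simp add: Bad_def walk_dist_def k_def L_def)
qed

theorem theorem5:
  fixes t :: real
  assumes "t > 0"
  shows "tendsto_in_probability graph_walk_space
           (\<lambda>n x. walk_dist n (nat \<lfloor>t * log 2 (real n)\<rfloor>) x / ereal (log 2 (real n)))
           (min (t / 3) 1)
           (inf sequentially (principal {n. even n}))"
  unfolding tendsto_in_probability_def
proof (intro allI impI)
  fix \<epsilon> :: real assume \<epsilon>: "\<epsilon> > 0"
  let ?F = "inf sequentially (principal {n::nat. even n})"
  let ?P = "\<lambda>n. measure (graph_walk_space n) {x \<in> space (graph_walk_space n).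
      \<bar>walk_dist n (nat \<lfloor>t * log 2 (real n)\<rfloor>) x / ereal (log 2 (real n)) - ereal (min (t / 3) 1)\<bar> > ereal \<epsilon>}"
  have "(\<lambda>n. 16 * t / \<epsilon>\<^sup>2 / log 2 (real n)) \<longlonglongrightarrow> 0" by real_asymp
  then have "(\<lambda>n. \<bar>deviation_bound (t / 3) \<epsilon> n\<bar> + 16 * t / \<epsilon>\<^sup>2 / log 2 (real n)) \<longlonglongrightarrow> 0"
    using assms tendsto_add[OF tendsto_rabs_zero[OF deviation_bound_tendsto[OF \<epsilon>, of "t / 3"]]] by force
  then have lim: "((\<lambda>n. \<bar>deviation_bound (t / 3) \<epsilon> n\<bar> + 16 * t / \<epsilon>\<^sup>2 / log 2 (real n)) \<longlongrightarrow> 0) ?F"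
    by (rule tendsto_mono[OF inf_le1])
  have "\<forall>\<^sub>F n::nat in sequentially. n \<ge> 2" by (rule eventually_ge_at_top)
  moreover note eventually_log_less_linear[of "t / 3 + \<epsilon> / 2"] eventually_log_less_linear[of "1 + \<epsilon>"]
  moreover have "\<forall>\<^sub>F n::nat in sequentially.
      3 * ((1 + \<epsilon>) * log 2 (real n))\<^sup>2 / (3 * real n - 2 * ((1 + \<epsilon>) * log 2 (real n))) < 1"
    by (rule order_tendstoD(2)[OF hit_tendsto_0]) (use \<epsilon> in auto)
  moreover have "\<forall>\<^sub>F n::nat in sequentially. 1 \<le> \<epsilon> / 4 * log 2 (real n)"
    using \<epsilon> by real_asymp
  \<comment> \<open>Evenness, which guarantees that a matching exists, stays a premise until the
    filter supplies it.\<close>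
  ultimately have "\<forall>\<^sub>F n in sequentially. even n \<longrightarrow>
      ?P n \<le> \<bar>deviation_bound (t / 3) \<epsilon> n\<bar> + 16 * t / \<epsilon>\<^sup>2 / log 2 (real n)"
  proof eventually_elim
    case (elim n)
    then show ?case using walk_deviation_le[OF _ _ assms \<epsilon> _ refl, of n] by (simp add: less_imp_le)
  qed
  then have "\<forall>\<^sub>F n in ?F. ?P n \<le> \<bar>deviation_bound (t / 3) \<epsilon> n\<bar> + 16 * t / \<epsilon>\<^sup>2 / log 2 (real n)"
    unfolding eventually_inf_principal by simp
  then show "(?P \<longlongrightarrow> 0) ?F"
    by (intro tendsto_sandwich[OF _ _ tendsto_const lim]) (auto simp: measure_nonneg)
qed

end
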